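(* Let $M$ be a connected finite-dimensional Riemannian manifold and let $S\subseteq M$ be a closed subset whose boundary $\partial S$ is an embedded $k$-dimensional submanifold of $M$. Let $x\in\partial S$. Then: (a) If $\partial S$ is of class $C^1$, then $N^P_S(x)\subseteq T^{\perp}_x\partial S$, where $T^{\perp}_x\partial S$ is the normal space to $\partial S$ at $x$ (the orthogonal complement of $T_x\partial S$ in $T_xM$). (b) If in addition $S$ is prox-regular with nonempty interior and $\partial S$ is of class $C^2$, then there exist a neighborhood $U$ of $x$ in $M$ and a $C^2$ submersion $\psi:U\to\mathbb{R}$ such that $U\cap\partial S=\psi^{-1}(0)$ and the proximal normal cone to $S$ at $x$ is one of the following: either $$N^P_S(x)=\operatorname{cone}\{\nabla\psi(x)\}\quad\text{or}\quad N^P_S(x)=\operatorname{span}\{\nabla\psi(x)\}.$$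
   Context: $M$ carries a Riemannian metric $\langle\cdot,\cdot\rangle$ with Riemannian distance $d$; $B(x,r)$ is the open metric ball. A convex set (or neighborhood, or ball) in $M$ means a strongly convex one: any two of its points are joined by a unique minimizing geodesic of $M$, and this geodesic lies in the set; for $x,y$ in a convex neighborhood, $\exp_x^{-1}y$ is the initial velocity of the minimizing geodesic $[0,1]\to M$ from $x$ to $y$. Proximal normal cone: for a nonempty closed $S\subseteq M$ and $x\in S$, $\xi\in T_xM$ belongs to $N^P_S(x)$ iff there is $\sigma>0$ such that $\langle\xi,\exp_x^{-1}y\rangle\le\sigma\, d^2(x,y)$ for every $y\in U\cap S$, where $U$ is a convex neighborhood of $x$. Prox-regular: a closed set $S\subseteq M$ is prox-regular at $\bar x\in S$ if there exist $\varepsilon>0$ and $\sigma>0$ such that $B(\bar x,\varepsilon)$ is convex and for every $x\in S\cap B(\bar x,\varepsilon)$ and $v\in N^P_S(x)$ with $\|v\|<\varepsilon$ one has $\langle v,\exp_x^{-1}y\rangle\le\sigma\,d^2(x,y)$ for every $y\in S\cap B(\bar x,\varepsilon)$. $S$ is prox-regular if it is so at each of its points. $\nabla\psi$ is the Riemannian gradient; $\operatorname{cone}\{w\}=\{\lambda w:\lambda\ge 0\}$ and $\operatorname{span}\{w\}=\{\lambda w:\lambda\in\mathbb{R}\}$. *)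

theory Defs
  imports "HOL-Analysis.Analysis"
begin

text \<open>
  Conventions.  The underlying set of the manifold is the whole type \<open>'m\<close>, with its type class
  topology; the model space is a Euclidean space \<open>'e\<close>, so the dimension is \<open>DIM('e)\<close>.
  A smooth structure is an atlas of charts, a chart being a pair of a domain and a map.
  Every point \<open>x\<close> has a preferred chart \<open>chart_at M x\<close>, and a tangent vector at \<open>x\<close>
  is represented by its coordinate vector in that chart.  Thus each tangent space is a copy of
  \<open>'e\<close> as a vector space, and \<open>metric M x\<close> is the inner product that the Riemannian metric
  puts on it.  Nothing below identifies tangent spaces at different points except through the
  derivatives of chart transitions.
\<close>

type_synonym ('m, 'e) chart = "'m set \<times> ('m \<Rightarrow> 'e)"

record ('m, 'e) riem_mfd =
  atlas :: "('m, 'e) chart set"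
  metric :: "'m \<Rightarrow> 'e \<Rightarrow> 'e \<Rightarrow> real"

abbreviation chart_dom :: "('m, 'e) chart \<Rightarrow> 'm set" where
  "chart_dom \<kappa> \<equiv> fst \<kappa>"

abbreviation chart_map :: "('m, 'e) chart \<Rightarrow> 'm \<Rightarrow> 'e" where
  "chart_map \<kappa> \<equiv> snd \<kappa>"

definition chart_inv :: "('m, 'e) chart \<Rightarrow> 'e \<Rightarrow> 'm" where
  "chart_inv \<kappa> = inv_into (chart_dom \<kappa>) (chart_map \<kappa>)"

text \<open>Class \<open>C\<^sup>k\<close> on an open subset of a Euclidean space.\<close>

primrec Ck_on ::
  "nat \<Rightarrow> ('a::euclidean_space \<Rightarrow> 'b::real_normed_vector) \<Rightarrow> 'a set \<Rightarrow> bool" where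
  "Ck_on 0 f U \<longleftrightarrow> continuous_on U f"
| "Ck_on (Suc k) f U \<longleftrightarrow>
     (\<forall>p\<in>U. f differentiable (at p)) \<and>
     (\<forall>v. Ck_on k (\<lambda>p. frechet_derivative f (at p) v) U)"

definition Ck_chart ::
  "('m::topological_space, 'e::euclidean_space) riem_mfd \<Rightarrow> nat \<Rightarrow> ('m, 'e) chart \<Rightarrow> bool" where
  "Ck_chart M r \<kappa> \<longleftrightarrow>
     open (chart_dom \<kappa>) \<and> open (chart_map \<kappa> ` chart_dom \<kappa>) \<and>
     homeomorphism (chart_dom \<kappa>) (chart_map \<kappa> ` chart_dom \<kappa>) (chart_map \<kappa>) (chart_inv \<kappa>) \<and>
     (\<forall>\<kappa>'\<in>atlas M.
        Ck_on r (chart_map \<kappa>' \<circ> chart_inv \<kappa>) (chart_map \<kappa> ` (chart_dom \<kappa> \<inter> chart_dom \<kappa>')) \<and>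
        Ck_on r (chart_map \<kappa> \<circ> chart_inv \<kappa>') (chart_map \<kappa>' ` (chart_dom \<kappa> \<inter> chart_dom \<kappa>')))"

definition smooth_atlas :: "('m::topological_space, 'e::euclidean_space) riem_mfd \<Rightarrow> bool" where
  "smooth_atlas M \<longleftrightarrow>
     (\<Union>\<kappa>\<in>atlas M. chart_dom \<kappa>) = UNIV \<and> (\<forall>\<kappa>\<in>atlas M. \<forall>r. Ck_chart M r \<kappa>)"

definition chart_at :: "('m, 'e) riem_mfd \<Rightarrow> 'm \<Rightarrow> ('m, 'e) chart" where
  "chart_at M x = (SOME \<kappa>. \<kappa> \<in> atlas M \<and> x \<in> chart_dom \<kappa>)"

text \<open>The tangent vector at \<open>x\<close> whose coordinate vector in the chart \<open>\<kappa>\<close> is \<open>u\<close>.\<close>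

definition tangent_of_coord ::
  "('m, 'e::euclidean_space) riem_mfd \<Rightarrow> ('m, 'e) chart \<Rightarrow> 'm \<Rightarrow> 'e \<Rightarrow> 'e" where
  "tangent_of_coord M \<kappa> x u =
     frechet_derivative (chart_map (chart_at M x) \<circ> chart_inv \<kappa>) (at (chart_map \<kappa> x)) u"

text \<open>The metric in the chart \<open>\<kappa>\<close>, at the point with coordinates \<open>p\<close>.\<close>

definition metric_coord ::
  "('m, 'e::euclidean_space) riem_mfd \<Rightarrow> ('m, 'e) chart \<Rightarrow> 'e \<Rightarrow> 'e \<Rightarrow> 'e \<Rightarrow> real" where
  "metric_coord M \<kappa> p u v =
     (let x = chart_inv \<kappa> p
      in metric M x (tangent_of_coord M \<kappa> x u) (tangent_of_coord M \<kappa> x v))"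

definition riemannian_manifold ::
  "('m::{t2_space,second_countable_topology}, 'e::euclidean_space) riem_mfd \<Rightarrow> bool" where
  "riemannian_manifold M \<longleftrightarrow>
     smooth_atlas M \<and>
     (\<forall>x. bilinear (metric M x) \<and>
          (\<forall>u v. metric M x u v = metric M x v u) \<and>
          (\<forall>u. u \<noteq> 0 \<longrightarrow> metric M x u u > 0)) \<and>
     (\<forall>\<kappa>\<in>atlas M. \<forall>u v r.
        Ck_on r (\<lambda>p. metric_coord M \<kappa> p u v) (chart_map \<kappa> ` chart_dom \<kappa>))"

definition tnorm :: "('m, 'e) riem_mfd \<Rightarrow> 'm \<Rightarrow> 'e \<Rightarrow> real" where
  "tnorm M x v = sqrt (metric M x v v)"


subsection \<open>Curves, length and distance\<close>

text \<open>All derivatives of curves defined on an interval \<open>I\<close> are taken within \<open>I\<close>, hence are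
  one-sided at the end points.\<close>

definition velocity ::
  "('m, 'e::euclidean_space) riem_mfd \<Rightarrow> real set \<Rightarrow> (real \<Rightarrow> 'm) \<Rightarrow> real \<Rightarrow> 'e" where
  "velocity M I c t =
     vector_derivative (\<lambda>s. chart_map (chart_at M (c t)) (c s)) (at t within I)"

definition C1_curve ::
  "('m::topological_space, 'e::euclidean_space) riem_mfd \<Rightarrow> real set \<Rightarrow> (real \<Rightarrow> 'm) \<Rightarrow> bool" where
  "C1_curve M I c \<longleftrightarrow>
     continuous_on I c \<and>
     (\<forall>\<kappa>\<in>atlas M. \<exists>D. continuous_on {t\<in>I. c t \<in> chart_dom \<kappa>} D \<and>
        (\<forall>t\<in>I. c t \<in> chart_dom \<kappa> \<longrightarrow>
           ((\<lambda>s. chart_map \<kappa> (c s)) has_vector_derivative D t) (at t within I)))"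

definition piecewise_C1_path ::
  "('m::topological_space, 'e::euclidean_space) riem_mfd \<Rightarrow> (real \<Rightarrow> 'm) \<Rightarrow> bool" where
  "piecewise_C1_path M c \<longleftrightarrow>
     (\<exists>F. finite F \<and> {0,1} \<subseteq> F \<and> F \<subseteq> {0..1} \<and>
        (\<forall>s\<in>F. \<forall>t\<in>F. s < t \<and> {s<..<t} \<inter> F = {} \<longrightarrow> C1_curve M {s..t} c))"

text \<open>For a piecewise \<open>C\<^sup>1\<close> path the velocity is undefined only at finitely many break points,
  which do not affect the integral.\<close>

definition curve_length ::
  "('m, 'e::euclidean_space) riem_mfd \<Rightarrow> (real \<Rightarrow> 'm) \<Rightarrow> real" where
  "curve_length M c = integral {0..1} (\<lambda>t. tnorm M (c t) (velocity M {0..1} c t))"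

definition riem_dist ::
  "('m::topological_space, 'e::euclidean_space) riem_mfd \<Rightarrow> 'm \<Rightarrow> 'm \<Rightarrow> real" where
  "riem_dist M x y =
     Inf {curve_length M c | c. piecewise_C1_path M c \<and> c 0 = x \<and> c 1 = y}"

definition riem_ball ::
  "('m::topological_space, 'e::euclidean_space) riem_mfd \<Rightarrow> 'm \<Rightarrow> real \<Rightarrow> 'm set" where
  "riem_ball M x r = {y. riem_dist M x y < r}"


subsection \<open>Geodesics and convexity\<close>

text \<open>Christoffel symbols of the first kind in a chart:
  \<open>christoffel1 M \<kappa> p a b w\<close> is the inner product of \<open>\<nabla>\<^sub>a b\<close> with \<open>w\<close> for constant coordinate
  fields \<open>a\<close>, \<open>b\<close>, \<open>w\<close> and the Levi-Civita connection (Koszul formula).\<close>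

definition christoffel1 ::
  "('m, 'e::euclidean_space) riem_mfd \<Rightarrow> ('m, 'e) chart \<Rightarrow> 'e \<Rightarrow> 'e \<Rightarrow> 'e \<Rightarrow> 'e \<Rightarrow> real" where
  "christoffel1 M \<kappa> p a b w =
     (frechet_derivative (\<lambda>q. metric_coord M \<kappa> q b w) (at p) a
      + frechet_derivative (\<lambda>q. metric_coord M \<kappa> q a w) (at p) b
      - frechet_derivative (\<lambda>q. metric_coord M \<kappa> q a b) (at p) w) / 2"

text \<open>The geodesic equation \<open>\<nabla>\<^bsub>c'\<^esub> c' = 0\<close> on \<open>[0,1]\<close>, in coordinates and with the index
  lowered, i.e. tested against every vector \<open>w\<close>.\<close>

definition geodesic ::
  "('m::topological_space, 'e::euclidean_space) riem_mfd \<Rightarrow> (real \<Rightarrow> 'm) \<Rightarrow> bool" where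
  "geodesic M c \<longleftrightarrow>
     continuous_on {0..1} c \<and>
     (\<forall>\<kappa>\<in>atlas M. \<exists>u' u''. \<forall>t\<in>{0..1}. c t \<in> chart_dom \<kappa> \<longrightarrow>
        ((\<lambda>s. chart_map \<kappa> (c s)) has_vector_derivative u' t) (at t within {0..1}) \<and>
        (u' has_vector_derivative u'' t) (at t within {0..1}) \<and>
        (\<forall>w. metric_coord M \<kappa> (chart_map \<kappa> (c t)) (u'' t) w
             + christoffel1 M \<kappa> (chart_map \<kappa> (c t)) (u' t) (u' t) w = 0))"

definition minimizing_geodesic ::
  "('m::topological_space, 'e::euclidean_space) riem_mfd \<Rightarrow> (real \<Rightarrow> 'm) \<Rightarrow> 'm \<Rightarrow> 'm \<Rightarrow> bool" where
  "minimizing_geodesic M c x y \<longleftrightarrow>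
     geodesic M c \<and> c 0 = x \<and> c 1 = y \<and> curve_length M c = riem_dist M x y"

text \<open>Uniqueness is uniqueness on \<open>[0,1]\<close>, since curves are total functions on the reals.\<close>

definition strongly_convex ::
  "('m::topological_space, 'e::euclidean_space) riem_mfd \<Rightarrow> 'm set \<Rightarrow> bool" where
  "strongly_convex M A \<longleftrightarrow>
     (\<forall>x\<in>A. \<forall>y\<in>A. \<exists>c. minimizing_geodesic M c x y \<and> c ` {0..1} \<subseteq> A \<and>
        (\<forall>c'. minimizing_geodesic M c' x y \<longrightarrow> (\<forall>t\<in>{0..1}. c' t = c t)))"

text \<open>Only meaningful when there is a unique minimizing geodesic from \<open>x\<close> to \<open>y\<close>, as in a
  strongly convex set.\<close>

definition exp_inv ::
  "('m::topological_space, 'e::euclidean_space) riem_mfd \<Rightarrow> 'm \<Rightarrow> 'm \<Rightarrow> 'e" where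
  "exp_inv M x y = (THE v. \<exists>c. minimizing_geodesic M c x y \<and> v = velocity M {0..1} c 0)"


subsection \<open>Proximal normals and prox-regularity\<close>

definition prox_normal_cone ::
  "('m::topological_space, 'e::euclidean_space) riem_mfd \<Rightarrow> 'm set \<Rightarrow> 'm \<Rightarrow> 'e set" where
  "prox_normal_cone M S x =
     {\<xi>. \<exists>\<sigma>>0. \<exists>U. x \<in> interior U \<and> strongly_convex M U \<and>
        (\<forall>y\<in>U \<inter> S. metric M x \<xi> (exp_inv M x y) \<le> \<sigma> * (riem_dist M x y)\<^sup>2)}"

definition prox_regular_at ::
  "('m::topological_space, 'e::euclidean_space) riem_mfd \<Rightarrow> 'm set \<Rightarrow> 'm \<Rightarrow> bool" where
  "prox_regular_at M S xbar \<longleftrightarrow>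
     (\<exists>\<epsilon>>0. \<exists>\<sigma>>0. strongly_convex M (riem_ball M xbar \<epsilon>) \<and>
        (\<forall>x\<in>S \<inter> riem_ball M xbar \<epsilon>. \<forall>v\<in>prox_normal_cone M S x. tnorm M x v < \<epsilon> \<longrightarrow>
           (\<forall>y\<in>S \<inter> riem_ball M xbar \<epsilon>.
              metric M x v (exp_inv M x y) \<le> \<sigma> * (riem_dist M x y)\<^sup>2)))"

definition prox_regular ::
  "('m::topological_space, 'e::euclidean_space) riem_mfd \<Rightarrow> 'm set \<Rightarrow> bool" where
  "prox_regular M S \<longleftrightarrow> closed S \<and> (\<forall>x\<in>S. prox_regular_at M S x)"


subsection \<open>Submanifolds and functions on the manifold\<close>

text \<open>Embedded \<open>k\<close>-dimensional submanifolds of class \<open>C\<^sup>r\<close>, via slice charts of class \<open>C\<^sup>r\<close>.\<close>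

definition embedded_submanifold ::
  "('m::topological_space, 'e::euclidean_space) riem_mfd \<Rightarrow> nat \<Rightarrow> nat \<Rightarrow> 'm set \<Rightarrow> bool" where
  "embedded_submanifold M r k N \<longleftrightarrow>
     (\<forall>p\<in>N. \<exists>\<kappa> L. Ck_chart M r \<kappa> \<and> p \<in> chart_dom \<kappa> \<and> subspace L \<and> dim L = k \<and>
        chart_map \<kappa> ` (chart_dom \<kappa> \<inter> N) = chart_map \<kappa> ` chart_dom \<kappa> \<inter> L)"

text \<open>The space of velocities at \<open>x\<close> of \<open>C\<^sup>1\<close> curves in \<open>N\<close>.\<close>

definition tangent_space_at ::
  "('m::topological_space, 'e::euclidean_space) riem_mfd \<Rightarrow> 'm set \<Rightarrow> 'm \<Rightarrow> 'e set" where
  "tangent_space_at M N x =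
     {velocity M {-1..1} c 0 | c. C1_curve M {-1..1} c \<and> c ` {-1..1} \<subseteq> N \<and> c 0 = x}"

definition normal_space_at ::
  "('m::topological_space, 'e::euclidean_space) riem_mfd \<Rightarrow> 'm set \<Rightarrow> 'm \<Rightarrow> 'e set" where
  "normal_space_at M N x = {v. \<forall>w\<in>tangent_space_at M N x. metric M x v w = 0}"

definition Ck_function ::
  "('m, 'e::euclidean_space) riem_mfd \<Rightarrow> nat \<Rightarrow> 'm set \<Rightarrow> ('m \<Rightarrow> real) \<Rightarrow> bool" where
  "Ck_function M r U \<psi> \<longleftrightarrow>
     (\<forall>\<kappa>\<in>atlas M. Ck_on r (\<psi> \<circ> chart_inv \<kappa>) (chart_map \<kappa> ` (chart_dom \<kappa> \<inter> U)))"

definition differential ::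
  "('m, 'e::euclidean_space) riem_mfd \<Rightarrow> ('m \<Rightarrow> real) \<Rightarrow> 'm \<Rightarrow> 'e \<Rightarrow> real" where
  "differential M \<psi> x =
     frechet_derivative (\<psi> \<circ> chart_inv (chart_at M x)) (at (chart_map (chart_at M x) x))"

definition Ck_submersion ::
  "('m, 'e::euclidean_space) riem_mfd \<Rightarrow> nat \<Rightarrow> 'm set \<Rightarrow> ('m \<Rightarrow> real) \<Rightarrow> bool" where
  "Ck_submersion M r U \<psi> \<longleftrightarrow> Ck_function M r U \<psi> \<and> (\<forall>p\<in>U. surj (differential M \<psi> p))"

definition gradient ::
  "('m, 'e::euclidean_space) riem_mfd \<Rightarrow> ('m \<Rightarrow> real) \<Rightarrow> 'm \<Rightarrow> 'e" where
  "gradient M \<psi> x = (THE v. \<forall>w. metric M x v w = differential M \<psi> x w)"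

end

(*
  In the preferred chart at x, a geodesic from x of length s satisfies |u'| = O(s) and, by the
  geodesic equation, |u''| = O(s^2); hence exp_x^{-1} y agrees with the coordinate difference
  w = u(y) - u(x) up to O(d(x,y)^2).  As d(x,y) = O(|w|) along coordinate lines, a proximal normal
  xi satisfies <xi, w> <= C |w|^2 for y in S near x.  Dividing by t along a curve in S starting at
  x gives <xi, velocity> <= 0, and (a) follows by running through a curve of the boundary in both
  directions.  Conversely the quadratic estimate makes xi a proximal normal as soon as x has some
  strongly convex neighbourhood, because <xi, exp_x^{-1} y> <= |xi| d(x,y) settles the y that are
  not close to x; prox-regularity enters (b) only by providing this neighbourhood.

  For (b), a subspace of codimension at least 2 does not disconnect a ball, so the boundary has
  codimension 1: otherwise the interior of S would contain all of a ball around one of its own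
  frontier points.  In a slice chart S is then locally a closed half ball or the hypersurface
  itself, which gives the cone or the span of the gradient of the linear function cutting out the
  slice.
*)

theory Submission
  imports Defs
begin

subsection \<open>Charts and transition maps\<close>

text \<open>Strong convexity itself supplies the minimizing geodesics behind \<open>exp_inv\<close>,
  so neither an exponential map nor an existence theory for geodesics is built; only estimates for a
  given geodesic enter. They are made in \<open>chart_at M x\<close> because tangent vectors at
  \<open>x\<close> are by convention coordinates in that chart, so that \<open>exp_inv M x y\<close>
  can be subtracted from a coordinate difference. Quadratic bounds pass both ways: coordinate lines
  bound distance by coordinate difference, and the constant speed of a geodesic bounds coordinate
  difference by distance.

  A slice chart has finite differentiability and need not belong to the atlas, so the metric is
  never examined in it. \<open>S\<close> is described in the slice chart while proximal normals are
  tested in the preferred chart. Straight lines of the slice chart run into \<open>S\<close> exactly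
  and bound the cone from above; the Taylor remainder of the slice function, where class C^2
  matters, places multiples of the gradient in the cone.\<close>

lemma Ck_on_differentiable: "Ck_on r f U \<Longrightarrow> 1 \<le> r \<Longrightarrow> p \<in> U \<Longrightarrow> f differentiable (at p)"
  by (cases r) auto

lemma Ck_on_mono: "Ck_on r f U \<Longrightarrow> V \<subseteq> U \<Longrightarrow> Ck_on r f V"
  by (induction r arbitrary: f) (auto intro: continuous_on_subset)

text \<open>A derivative at a point of \<open>U\<close> sees values on a full neighbourhood, so
  agreement on \<open>U\<close> passes to derivatives because \<open>U\<close> is open.\<close>

lemma Ck_on_cong:
  assumes "open U" "\<And>p. p \<in> U \<Longrightarrow> f p = g p" "Ck_on r f U"
  shows "Ck_on r g U"
  using assms(2,3)
proof (induction r arbitrary: f g)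
  case 0
  then show ?case by (simp cong: continuous_on_cong)
next
  case (Suc r)
  have d: "(g has_derivative frechet_derivative f (at p)) (at p)" if "p \<in> U" for p
  proof -
    have "(f has_derivative frechet_derivative f (at p)) (at p)"
      using Suc.prems that by (simp add: frechet_derivative_works[symmetric])
    then show ?thesis
      by (rule has_derivative_transform_within_open[OF _ assms(1) that]) (simp add: Suc.prems)
  qed
  then have e: "frechet_derivative f (at p) = frechet_derivative g (at p)" if "p \<in> U" for p
    using frechet_derivative_at that by blast
  have "Ck_on r (\<lambda>p. frechet_derivative g (at p) v) U" for v
    by (rule Suc.IH[of "\<lambda>p. frechet_derivative f (at p) v"]) (use Suc.prems e in auto)
  then show ?case
    using d by (auto simp: differentiable_def)
qed

lemma Ck_on_inner:
  fixes f :: "'a::euclidean_space \<Rightarrow> 'b::euclidean_space"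
  assumes "open U" "Ck_on r f U"
  shows "Ck_on r (\<lambda>p. a \<bullet> f p) U"
  using assms(2)
proof (induction r arbitrary: f)
  case 0
  then show ?case by (simp add: continuous_intros)
next
  case (Suc r)
  have d: "((\<lambda>p. a \<bullet> f p) has_derivative (\<lambda>v. a \<bullet> frechet_derivative f (at p) v)) (at p)"
    if "p \<in> U" for p
    using Suc.prems that by (auto intro!: derivative_eq_intros simp: frechet_derivative_works[symmetric])
  then have e: "frechet_derivative (\<lambda>p. a \<bullet> f p) (at p) = (\<lambda>v. a \<bullet> frechet_derivative f (at p) v)"
    if "p \<in> U" for p
    using frechet_derivative_at that by metis
  have "Ck_on r (\<lambda>p. frechet_derivative (\<lambda>p. a \<bullet> f p) (at p) v) U" for v
    by (rule Ck_on_cong[OF assms(1), of "\<lambda>p. a \<bullet> frechet_derivative f (at p) v"])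
      (use Suc e in auto)
  then show ?case using d by (auto simp: differentiable_def)
qed

lemma Ck_chartD:
  assumes "Ck_chart M r \<kappa>"
  shows "open (chart_dom \<kappa>)" "open (chart_map \<kappa> ` chart_dom \<kappa>)"
    "homeomorphism (chart_dom \<kappa>) (chart_map \<kappa> ` chart_dom \<kappa>) (chart_map \<kappa>) (chart_inv \<kappa>)"
    "z \<in> chart_dom \<kappa> \<Longrightarrow> chart_inv \<kappa> (chart_map \<kappa> z) = z"
    "p \<in> chart_map \<kappa> ` chart_dom \<kappa> \<Longrightarrow> chart_map \<kappa> (chart_inv \<kappa> p) = p"
    "p \<in> chart_map \<kappa> ` chart_dom \<kappa> \<Longrightarrow> chart_inv \<kappa> p \<in> chart_dom \<kappa>"
    "continuous_on (chart_dom \<kappa>) (chart_map \<kappa>)"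
    "continuous_on (chart_map \<kappa> ` chart_dom \<kappa>) (chart_inv \<kappa>)"
proof -
  show h: "open (chart_dom \<kappa>)" "open (chart_map \<kappa> ` chart_dom \<kappa>)"
    "homeomorphism (chart_dom \<kappa>) (chart_map \<kappa> ` chart_dom \<kappa>) (chart_map \<kappa>) (chart_inv \<kappa>)"
    using assms unfolding Ck_chart_def by auto
  from h(3) show "z \<in> chart_dom \<kappa> \<Longrightarrow> chart_inv \<kappa> (chart_map \<kappa> z) = z"
    "p \<in> chart_map \<kappa> ` chart_dom \<kappa> \<Longrightarrow> chart_map \<kappa> (chart_inv \<kappa> p) = p"
    "p \<in> chart_map \<kappa> ` chart_dom \<kappa> \<Longrightarrow> chart_inv \<kappa> p \<in> chart_dom \<kappa>"
    "continuous_on (chart_dom \<kappa>) (chart_map \<kappa>)"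
    "continuous_on (chart_map \<kappa> ` chart_dom \<kappa>) (chart_inv \<kappa>)"
    unfolding homeomorphism_def by auto
qed

lemma Ck_chart_open_image:
  assumes "Ck_chart M r \<kappa>" "open V"
  shows "open (chart_map \<kappa> ` (chart_dom \<kappa> \<inter> V))"
proof -
  note h = Ck_chartD[OF assms(1)]
  have "openin (top_of_set (chart_dom \<kappa>)) (chart_dom \<kappa> \<inter> V)"
    using assms(2) by (simp add: openin_open_Int)
  then have "openin (top_of_set (chart_map \<kappa> ` chart_dom \<kappa>)) (chart_map \<kappa> ` (chart_dom \<kappa> \<inter> V))"
    using h(3) homeomorphism_imp_open_map by blast
  then show ?thesis using h(2) openin_open_trans by blast
qed

lemma Ck_chart_open_inv_image:
  assumes "Ck_chart M r \<kappa>" "open V" "V \<subseteq> chart_map \<kappa> ` chart_dom \<kappa>"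
  shows "open (chart_inv \<kappa> ` V)"
proof -
  note h = Ck_chartD[OF assms(1)]
  have "openin (top_of_set (chart_map \<kappa> ` chart_dom \<kappa>)) V"
    using assms(2,3) openin_open_eq h(2) by blast
  then have "openin (top_of_set (chart_dom \<kappa>)) (chart_inv \<kappa> ` V)"
    using h(3) homeomorphism_imp_open_map homeomorphism_symD by blast
  then show ?thesis using h(1) openin_open_trans by blast
qed

locale riem =
  fixes M :: "('m::{t2_space,second_countable_topology}, 'e::euclidean_space) riem_mfd"
  assumes riemannian: "riemannian_manifold M"
begin

text \<open>The base point is kept on the manifold, so that two opposite transitions share the
  argument \<open>z\<close> although they are differentiated at different coordinate points.\<close>

abbreviation trans_deriv :: "('m,'e) chart \<Rightarrow> ('m,'e) chart \<Rightarrow> 'm \<Rightarrow> 'e \<Rightarrow> 'e" where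
  "trans_deriv \<kappa> \<kappa>' z \<equiv> frechet_derivative (chart_map \<kappa>' \<circ> chart_inv \<kappa>) (at (chart_map \<kappa> z))"

lemma atlas_chart: "\<kappa> \<in> atlas M \<Longrightarrow> Ck_chart M r \<kappa>"
  using riemannian by (auto simp: riemannian_manifold_def smooth_atlas_def)

lemma chart_at: "chart_at M z \<in> atlas M" "z \<in> chart_dom (chart_at M z)"
proof -
  have "\<exists>\<kappa>. \<kappa> \<in> atlas M \<and> z \<in> chart_dom \<kappa>"
    using riemannian unfolding riemannian_manifold_def smooth_atlas_def by blast
  from someI_ex[OF this] show "chart_at M z \<in> atlas M" "z \<in> chart_dom (chart_at M z)"
    by (auto simp: chart_at_def)
qed

lemma transition_Ck:
  assumes "Ck_chart M r \<kappa>" "\<kappa>' \<in> atlas M"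
  shows "Ck_on r (chart_map \<kappa>' \<circ> chart_inv \<kappa>) (chart_map \<kappa> ` (chart_dom \<kappa> \<inter> chart_dom \<kappa>'))"
    "Ck_on r (chart_map \<kappa> \<circ> chart_inv \<kappa>') (chart_map \<kappa>' ` (chart_dom \<kappa> \<inter> chart_dom \<kappa>'))"
  using assms by (auto simp: Ck_chart_def)

text \<open>The chain rule applied to two composites that are the identity near the base point. Only
  \<open>\<kappa>'\<close> is taken from the atlas, so \<open>\<kappa>\<close> may be a slice chart
  of class \<open>r\<close>.\<close>

lemma transition_deriv:
  assumes "Ck_chart M r \<kappa>" "1 \<le> r" "\<kappa>' \<in> atlas M" "z \<in> chart_dom \<kappa>" "z \<in> chart_dom \<kappa>'"
  shows "((chart_map \<kappa>' \<circ> chart_inv \<kappa>) has_derivative trans_deriv \<kappa> \<kappa>' z) (at (chart_map \<kappa> z))"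
    "((chart_map \<kappa> \<circ> chart_inv \<kappa>') has_derivative trans_deriv \<kappa>' \<kappa> z) (at (chart_map \<kappa>' z))"
    "trans_deriv \<kappa>' \<kappa> z (trans_deriv \<kappa> \<kappa>' z u) = u"
    "trans_deriv \<kappa> \<kappa>' z (trans_deriv \<kappa>' \<kappa> z u) = u"
    "linear (trans_deriv \<kappa> \<kappa>' z)" "linear (trans_deriv \<kappa>' \<kappa> z)"
proof -
  note k = Ck_chartD[OF assms(1)]
  note k' = Ck_chartD[OF atlas_chart[OF assms(3)]]
  show d1: "((chart_map \<kappa>' \<circ> chart_inv \<kappa>) has_derivative trans_deriv \<kappa> \<kappa>' z) (at (chart_map \<kappa> z))"
    by (rule frechet_derivative_works[THEN iffD1], rule Ck_on_differentiable[OF transition_Ck(1)[OF assms(1,3)]])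
      (use assms in auto)
  show d2: "((chart_map \<kappa> \<circ> chart_inv \<kappa>') has_derivative trans_deriv \<kappa>' \<kappa> z) (at (chart_map \<kappa>' z))"
    by (rule frechet_derivative_works[THEN iffD1], rule Ck_on_differentiable[OF transition_Ck(2)[OF assms(1,3)]])
      (use assms in auto)
  show "linear (trans_deriv \<kappa> \<kappa>' z)" "linear (trans_deriv \<kappa>' \<kappa> z)"
    using d1 d2 has_derivative_linear by blast+
  have "((chart_map \<kappa> \<circ> chart_inv \<kappa>') \<circ> (chart_map \<kappa>' \<circ> chart_inv \<kappa>) has_derivative
     trans_deriv \<kappa>' \<kappa> z \<circ> trans_deriv \<kappa> \<kappa>' z) (at (chart_map \<kappa> z))"
    by (rule diff_chain_at[OF d1]) (use d2 k(4) assms in simp)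
  \<comment> \<open>The composite agrees with \<open>id\<close> only on the coordinate image of the
    overlap, which is open.\<close>
  then have "(id has_derivative trans_deriv \<kappa>' \<kappa> z \<circ> trans_deriv \<kappa> \<kappa>' z) (at (chart_map \<kappa> z))"
    by (rule has_derivative_transform_within_open[OF _ Ck_chart_open_image[OF assms(1) k'(1)]])
      (use k(4) k'(4) assms in auto)
  then have "trans_deriv \<kappa>' \<kappa> z \<circ> trans_deriv \<kappa> \<kappa>' z = id"
    using frechet_derivative_at frechet_derivative_id by metis
  then show "trans_deriv \<kappa>' \<kappa> z (trans_deriv \<kappa> \<kappa>' z u) = u"
    by (metis comp_apply id_apply)
  have "((chart_map \<kappa>' \<circ> chart_inv \<kappa>) \<circ> (chart_map \<kappa> \<circ> chart_inv \<kappa>') has_derivative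
     trans_deriv \<kappa> \<kappa>' z \<circ> trans_deriv \<kappa>' \<kappa> z) (at (chart_map \<kappa>' z))"
    by (rule diff_chain_at[OF d2]) (use d1 k'(4) assms in simp)
  then have "(id has_derivative trans_deriv \<kappa> \<kappa>' z \<circ> trans_deriv \<kappa>' \<kappa> z) (at (chart_map \<kappa>' z))"
    by (rule has_derivative_transform_within_open[OF _
          Ck_chart_open_image[OF atlas_chart[OF assms(3)] k(1)]])
      (use k(4) k'(4) assms in auto)
  then have "trans_deriv \<kappa> \<kappa>' z \<circ> trans_deriv \<kappa>' \<kappa> z = id"
    using frechet_derivative_at frechet_derivative_id by metis
  then show "trans_deriv \<kappa> \<kappa>' z (trans_deriv \<kappa>' \<kappa> z u) = u"
    by (metis comp_apply id_apply)
qed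

lemma tangent_of_coord_eq: "tangent_of_coord M \<kappa> z = trans_deriv \<kappa> (chart_at M z) z"
  by (auto simp: tangent_of_coord_def)

lemma tangent_of_coord_self: "tangent_of_coord M (chart_at M z) z u = u"
proof -
  have "trans_deriv (chart_at M z) (chart_at M z) z (trans_deriv (chart_at M z) (chart_at M z) z u) = u"
    by (rule transition_deriv(3)[where r=1]) (auto simp: chart_at atlas_chart)
  note k = Ck_chartD[OF atlas_chart[OF chart_at(1)[of z], of 1]]
  have "((chart_map (chart_at M z) \<circ> chart_inv (chart_at M z)) has_derivative id) (at (chart_map (chart_at M z) z))"
    by (rule has_derivative_transform_within_open[OF _ k(2), of id]) (use k chart_at in auto)
  then show ?thesis
    using frechet_derivative_at unfolding tangent_of_coord_eq by (metis id_apply)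
qed

lemma metric_props:
  "bilinear (metric M z)" "metric M z u v = metric M z v u" "u \<noteq> 0 \<Longrightarrow> metric M z u u > 0"
  using riemannian by (auto simp: riemannian_manifold_def)

text \<open>\<open>velocity\<close> refers to the preferred chart of \<open>c t\<close>, which
  changes with \<open>t\<close>; this moves the computation to one fixed chart. The last assumption
  makes the derivative within \<open>I\<close> unique.\<close>

lemma velocity_eq:
  assumes "\<kappa> \<in> atlas M" "c t \<in> chart_dom \<kappa>" "continuous (at t within I) c" "t \<in> I"
    "((\<lambda>s. chart_map \<kappa> (c s)) has_vector_derivative D) (at t within I)"
    "at t within I \<noteq> bot"
  shows "velocity M I c t = tangent_of_coord M \<kappa> (c t) D"
proof -
  let ?k = "chart_at M (c t)"
  let ?F = "chart_map ?k \<circ> chart_inv \<kappa>"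
  note k = Ck_chartD[OF atlas_chart[OF assms(1), of 1]]
  have d: "(?F has_derivative trans_deriv \<kappa> ?k (c t)) (at (chart_map \<kappa> (c t)))"
    by (rule transition_deriv(1)[where r=1]) (use assms in \<open>auto simp: chart_at atlas_chart\<close>)
  have "((?F \<circ> (\<lambda>s. chart_map \<kappa> (c s))) has_vector_derivative trans_deriv \<kappa> ?k (c t) D) (at t within I)"
    by (rule vector_derivative_diff_chain_within[OF assms(5) has_derivative_at_withinI[OF d]])
  moreover have "\<forall>\<^sub>F s in at t within I. c s \<in> chart_dom \<kappa>"
    using assms(2,3) k(1) by (simp add: continuous_within topological_tendstoD)
  then have "\<forall>\<^sub>F s in at t within I. (?F \<circ> (\<lambda>s. chart_map \<kappa> (c s))) s = chart_map ?k (c s)"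
    by eventually_elim (use k(4) in auto)
  ultimately have "((\<lambda>s. chart_map ?k (c s)) has_vector_derivative trans_deriv \<kappa> ?k (c t) D) (at t within I)"
    unfolding has_vector_derivative_def
    by (rule has_derivative_transform_eventually) (use assms k(4) in auto)
  then show ?thesis unfolding velocity_def tangent_of_coord_eq
    using assms(6) vector_derivative_within by blast
qed

end

subsection \<open>The metric in coordinates\<close>

text \<open>Smoothness of the metric is given for fixed coordinate vectors only. The expansion
  reduces joint dependence on point and vectors to finitely many coefficient functions.\<close>

lemma bilinear_expand:
  fixes h :: "'a::euclidean_space \<Rightarrow> 'b::euclidean_space \<Rightarrow> real"
  assumes "bilinear h"
  shows "h u v = (\<Sum>i\<in>Basis. \<Sum>j\<in>Basis. (u \<bullet> i) * (v \<bullet> j) * h i j)"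
proof -
  have "h u v = h (\<Sum>i\<in>Basis. (u \<bullet> i) *\<^sub>R i) (\<Sum>j\<in>Basis. (v \<bullet> j) *\<^sub>R j)"
    by (simp add: euclidean_representation)
  also have "\<dots> = (\<Sum>(i,j)\<in>Basis \<times> Basis. h ((u \<bullet> i) *\<^sub>R i) ((v \<bullet> j) *\<^sub>R j))"
    by (rule bilinear_sum[OF assms])
  also have "\<dots> = (\<Sum>i\<in>Basis. \<Sum>j\<in>Basis. (u \<bullet> i) * (v \<bullet> j) * h i j)"
    using assms by (simp add: sum.cartesian_product bilinear_lmul bilinear_rmul mult.assoc)
  finally show ?thesis .
qed

context riem
begin

lemma metric_coord_eq:
  assumes "\<kappa> \<in> atlas M" "z \<in> chart_dom \<kappa>"
  shows "metric_coord M \<kappa> (chart_map \<kappa> z) u v =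
    metric M z (tangent_of_coord M \<kappa> z u) (tangent_of_coord M \<kappa> z v)"
  using Ck_chartD(4)[OF atlas_chart[OF assms(1)] assms(2)] by (simp add: metric_coord_def Let_def)

lemma metric_coord_self: "metric_coord M (chart_at M z) (chart_map (chart_at M z) z) u v = metric M z u v"
  by (simp add: metric_coord_eq chart_at tangent_of_coord_self)

text \<open>Positivity survives the change of chart because \<open>tangent_of_coord\<close> is
  injective, its left inverse being the derivative of the opposite transition.\<close>

lemma metric_coord_props:
  assumes "\<kappa> \<in> atlas M" "p \<in> chart_map \<kappa> ` chart_dom \<kappa>"
  shows "bilinear (metric_coord M \<kappa> p)" "metric_coord M \<kappa> p u v = metric_coord M \<kappa> p v u"
    "u \<noteq> 0 \<Longrightarrow> metric_coord M \<kappa> p u u > 0"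
proof -
  from assms(2) obtain z where z: "z \<in> chart_dom \<kappa>" "p = chart_map \<kappa> z" by auto
  have tr: "linear (tangent_of_coord M \<kappa> z)"
    unfolding tangent_of_coord_eq
    by (rule transition_deriv[where r=1]) (use assms z in \<open>auto simp: atlas_chart chart_at\<close>)
  have inj: "trans_deriv (chart_at M z) \<kappa> z (tangent_of_coord M \<kappa> z w) = w" for w
    unfolding tangent_of_coord_eq
    by (rule transition_deriv[where r=1]) (use assms z in \<open>auto simp: atlas_chart chart_at\<close>)
  have lin: "linear (trans_deriv (chart_at M z) \<kappa> z)"
    by (rule transition_deriv[where r=1]) (use assms z in \<open>auto simp: atlas_chart chart_at\<close>)
  have b: "linear (\<lambda>v. metric M z u v)" "linear (\<lambda>v. metric M z v u)" for u
    using metric_props(1)[of z] unfolding bilinear_def by auto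
  show "bilinear (metric_coord M \<kappa> p)"
    unfolding bilinear_def z metric_coord_eq[OF assms(1) z(1)]
    using linear_compose[OF tr b(1)] linear_compose[OF tr b(2)] by (auto simp: o_def)
  show "metric_coord M \<kappa> p u v = metric_coord M \<kappa> p v u"
    unfolding z metric_coord_eq[OF assms(1) z(1)] by (rule metric_props)
  show "metric_coord M \<kappa> p u u > 0" if "u \<noteq> 0"
  proof -
    have "tangent_of_coord M \<kappa> z u \<noteq> 0"
      using inj[of u] that linear_0[OF lin] by auto
    then show ?thesis
      unfolding z metric_coord_eq[OF assms(1) z(1)] by (rule metric_props)
  qed
qed

abbreviation metric_deriv :: "('m,'e) chart \<Rightarrow> 'e \<Rightarrow> 'e \<Rightarrow> 'e \<Rightarrow> 'e \<Rightarrow> real" where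
  "metric_deriv \<kappa> p u v \<equiv> frechet_derivative (\<lambda>q. metric_coord M \<kappa> q u v) (at p)"

lemma metric_coord_Ck:
  "\<kappa> \<in> atlas M \<Longrightarrow> Ck_on r (\<lambda>p. metric_coord M \<kappa> p u v) (chart_map \<kappa> ` chart_dom \<kappa>)"
  using riemannian by (simp add: riemannian_manifold_def)

lemma metric_coord_deriv:
  assumes "\<kappa> \<in> atlas M" "p \<in> chart_map \<kappa> ` chart_dom \<kappa>"
  shows "((\<lambda>q. metric_coord M \<kappa> q u v) has_derivative metric_deriv \<kappa> p u v) (at p)"
  unfolding frechet_derivative_works[symmetric]
  by (rule Ck_on_differentiable[OF metric_coord_Ck[OF assms(1), of 1]]) (use assms in auto)

lemma metric_deriv_continuous:
  assumes "\<kappa> \<in> atlas M"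
  shows "continuous_on (chart_map \<kappa> ` chart_dom \<kappa>) (\<lambda>p. metric_deriv \<kappa> p u v w)"
  using metric_coord_Ck[OF assms, of "Suc 0"] by simp

lemma metric_coord_continuous:
  assumes "\<kappa> \<in> atlas M"
  shows "continuous_on (chart_map \<kappa> ` chart_dom \<kappa>) (\<lambda>p. metric_coord M \<kappa> p u v)"
  using metric_coord_Ck[OF assms, of 0] by simp

lemma metric_coord_expand:
  assumes "\<kappa> \<in> atlas M" "p \<in> chart_map \<kappa> ` chart_dom \<kappa>"
  shows "metric_coord M \<kappa> p u v = (\<Sum>i\<in>Basis. \<Sum>j\<in>Basis. (u \<bullet> i) * (v \<bullet> j) * metric_coord M \<kappa> p i j)"
  by (rule bilinear_expand[OF metric_coord_props(1)[OF assms]])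

lemma metric_deriv_expand:
  assumes "\<kappa> \<in> atlas M" "p \<in> chart_map \<kappa> ` chart_dom \<kappa>"
  shows "metric_deriv \<kappa> p u v w = (\<Sum>i\<in>Basis. \<Sum>j\<in>Basis. (u \<bullet> i) * (v \<bullet> j) * metric_deriv \<kappa> p i j w)"
proof -
  have "((\<lambda>q. \<Sum>i\<in>Basis. \<Sum>j\<in>Basis. (u \<bullet> i) * (v \<bullet> j) * metric_coord M \<kappa> q i j) has_derivative
     (\<lambda>w. \<Sum>i\<in>Basis. \<Sum>j\<in>Basis. (u \<bullet> i) * (v \<bullet> j) * metric_deriv \<kappa> p i j w)) (at p)"
    by (intro has_derivative_sum has_derivative_mult_right metric_coord_deriv assms)
  then have "((\<lambda>q. metric_coord M \<kappa> q u v) has_derivative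
     (\<lambda>w. \<Sum>i\<in>Basis. \<Sum>j\<in>Basis. (u \<bullet> i) * (v \<bullet> j) * metric_deriv \<kappa> p i j w)) (at p)"
    by (rule has_derivative_transform_within_open[OF _ Ck_chartD(2)[OF atlas_chart[OF assms(1), of 1]] assms(2)])
      (rule metric_coord_expand[OF assms(1), symmetric])
  from frechet_derivative_at[OF this] show ?thesis by (rule fun_cong[symmetric])
qed

text \<open>By homogeneity unit vectors suffice, and on the compact product of \<open>K\<close> with
  the unit sphere the quadratic form attains a positive minimum and a maximum.\<close>

lemma metric_coord_bounds:
  assumes "\<kappa> \<in> atlas M" "compact K" "K \<subseteq> chart_map \<kappa> ` chart_dom \<kappa>"
  obtains c C where "c > 0" "C > 0"
    "\<And>p u. p \<in> K \<Longrightarrow> c * (norm u)\<^sup>2 \<le> metric_coord M \<kappa> p u u"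
    "\<And>p u. p \<in> K \<Longrightarrow> metric_coord M \<kappa> p u u \<le> C * (norm u)\<^sup>2"
proof (cases "K = {}")
  case True
  then show ?thesis using that[of 1 1] by auto
next
  case False
  let ?A = "K \<times> sphere (0::'e) 1"
  let ?f = "\<lambda>z. metric_coord M \<kappa> (fst z) (snd z) (snd z)"
  let ?h = "\<lambda>z. \<Sum>i\<in>Basis. \<Sum>j\<in>Basis. (snd z \<bullet> i) * (snd z \<bullet> j) * metric_coord M \<kappa> (fst z) i j"
  have ex: "?f z = ?h z" if "fst z \<in> K" for z
    by (rule metric_coord_expand[OF assms(1)]) (use assms(3) that in auto)
  have "continuous_on ?A ?h"
    by (intro continuous_intros continuous_on_compose2[OF metric_coord_continuous[OF assms(1)] continuous_on_fst])
       (use assms(3) in \<open>auto intro!: continuous_intros\<close>)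
  then have cont: "continuous_on ?A ?f"
    by (rule continuous_on_eq) (use ex in auto)
  have cpt: "compact ?A" using assms(2) by (intro compact_Times) auto
  obtain b :: 'e where "b \<in> Basis" using nonempty_Basis by blast
  then have ne: "?A \<noteq> {}" using False by auto
  obtain z1 where z1: "z1 \<in> ?A" "\<And>y. y \<in> ?A \<Longrightarrow> ?f z1 \<le> ?f y"
    using continuous_attains_inf[OF cpt ne cont] by auto
  obtain z2 where z2: "z2 \<in> ?A" "\<And>y. y \<in> ?A \<Longrightarrow> ?f y \<le> ?f z2"
    using continuous_attains_sup[OF cpt ne cont] by auto
  have pos: "?f z > 0" if "z \<in> ?A" for z
    using that assms(3) by (intro metric_coord_props[OF assms(1)]) auto
  have sc: "metric_coord M \<kappa> p u u = (norm u)\<^sup>2 * metric_coord M \<kappa> p (u /\<^sub>R norm u) (u /\<^sub>R norm u)"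
    if "p \<in> K" "u \<noteq> 0" for p u
    using metric_coord_props(1)[OF assms(1), of p] assms(3) that
    by (auto simp: bilinear_lmul bilinear_rmul power2_eq_square field_simps)
  have z: "metric_coord M \<kappa> p 0 0 = 0" if "p \<in> K" for p
    using metric_coord_props(1)[OF assms(1), of p] assms(3) that bilinear_lzero by blast
  show ?thesis
  proof (rule that[of "?f z1" "?f z2"])
    show "?f z1 > 0" "?f z2 > 0" using pos z1 z2 by blast+
    fix p u assume p: "p \<in> K"
    show "?f z1 * (norm u)\<^sup>2 \<le> metric_coord M \<kappa> p u u"
    proof (cases "u = 0")
      case False
      then have "?f z1 \<le> metric_coord M \<kappa> p (u /\<^sub>R norm u) (u /\<^sub>R norm u)"
        using z1(2)[of "(p, u /\<^sub>R norm u)"] p by simp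
      then show ?thesis unfolding sc[OF p False] by (simp add: mult.commute mult_left_mono)
    qed (simp add: z p)
    show "metric_coord M \<kappa> p u u \<le> ?f z2 * (norm u)\<^sup>2"
    proof (cases "u = 0")
      case False
      then have "metric_coord M \<kappa> p (u /\<^sub>R norm u) (u /\<^sub>R norm u) \<le> ?f z2"
        using z2(2)[of "(p, u /\<^sub>R norm u)"] p by simp
      then show ?thesis unfolding sc[OF p False] by (simp add: mult.commute mult_left_mono)
    qed (simp add: z p)
  qed
qed

text \<open>Basis expansion bounds each term of the Koszul formula by the sum of the absolute first
  derivatives of the metric coefficients, which is continuous in the point and so bounded on
  \<open>K\<close>.\<close>

lemma christoffel_bound:
  assumes "\<kappa> \<in> atlas M" "compact K" "K \<subseteq> chart_map \<kappa> ` chart_dom \<kappa>"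
  obtains C where "C > 0"
    "\<And>p u w. p \<in> K \<Longrightarrow> \<bar>christoffel1 M \<kappa> p u u w\<bar> \<le> C * (norm u)\<^sup>2 * norm w"
proof -
  let ?Q = "\<lambda>p. \<Sum>i\<in>(Basis::'e set). \<Sum>j\<in>(Basis::'e set). \<Sum>k\<in>(Basis::'e set). \<bar>metric_deriv \<kappa> p i j k\<bar>"
  have "continuous_on K ?Q"
    by (intro continuous_intros continuous_on_subset[OF metric_deriv_continuous[OF assms(1)] assms(3)])
  then have "compact (?Q ` K)" using assms(2) compact_continuous_image by blast
  then obtain B where "\<forall>y\<in>?Q ` K. norm y \<le> B"
    using compact_imp_bounded bounded_iff by blast
  then have B: "\<bar>?Q p\<bar> \<le> B" if "p \<in> K" for p
    using that by simp
  have bd: "\<bar>metric_deriv \<kappa> p u v w\<bar> \<le> \<bar>B\<bar> * (norm u * norm v * norm w)" if p: "p \<in> K" for p u v w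
  proof -
    have pP: "p \<in> chart_map \<kappa> ` chart_dom \<kappa>" using p assms(3) by auto
    have lin: "metric_deriv \<kappa> p i j w = (\<Sum>k\<in>Basis. (w \<bullet> k) * metric_deriv \<kappa> p i j k)" for i j
      using Linear_Algebra.linear_componentwise[OF has_derivative_linear[OF metric_coord_deriv[OF assms(1) pP, of i j]], of w 1]
      by simp
    have "\<bar>metric_deriv \<kappa> p u v w\<bar> =
      \<bar>\<Sum>i\<in>Basis. \<Sum>j\<in>Basis. (u \<bullet> i) * (v \<bullet> j) * (\<Sum>k\<in>Basis. (w \<bullet> k) * metric_deriv \<kappa> p i j k)\<bar>"
      by (simp only: metric_deriv_expand[OF assms(1) pP, of u v w] lin[symmetric])
    also have "\<dots> = \<bar>\<Sum>i\<in>Basis. \<Sum>j\<in>Basis. \<Sum>k\<in>Basis. (u \<bullet> i) * (v \<bullet> j) * (w \<bullet> k) * metric_deriv \<kappa> p i j k\<bar>"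
      by (simp add: sum_distrib_left mult.assoc)
    also have "\<dots> \<le> (\<Sum>i\<in>Basis. \<Sum>j\<in>Basis. \<Sum>k\<in>Basis. \<bar>(u \<bullet> i) * (v \<bullet> j) * (w \<bullet> k) * metric_deriv \<kappa> p i j k\<bar>)"
      by (intro order_trans[OF sum_abs] sum_mono order_refl)
    also have "\<dots> \<le> (\<Sum>i\<in>Basis. \<Sum>j\<in>Basis. \<Sum>k\<in>Basis. (norm u * norm v * norm w) * \<bar>metric_deriv \<kappa> p i j k\<bar>)"
      unfolding abs_mult
      by (intro sum_mono mult_right_mono mult_mono) (auto simp: Basis_le_norm)
    also have "\<dots> = (norm u * norm v * norm w) * ?Q p"
      by (simp add: sum_distrib_left)
    also have "\<dots> \<le> (norm u * norm v * norm w) * \<bar>B\<bar>"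
      using B[OF p] by (intro mult_left_mono) auto
    finally show ?thesis by (simp add: mult.commute)
  qed
  show ?thesis
  \<comment> \<open>The formula has three terms, and its division by 2 is discarded. The summand 1
    keeps the constant positive when the bound vanishes; the absolute value is there because
    \<open>B\<close> has no sign for empty \<open>K\<close>.\<close>
  proof (rule that[of "3 * \<bar>B\<bar> + 1"])
    fix p u w assume p: "p \<in> K"
    have "\<bar>christoffel1 M \<kappa> p u u w\<bar> \<le> 3 * (\<bar>B\<bar> * (norm u * norm u * norm w))"
      unfolding christoffel1_def
      using bd[OF p, of u w u] bd[OF p, of u u w] by (simp add: ac_simps)
    also have "\<dots> \<le> (3 * \<bar>B\<bar> + 1) * ((norm u)\<^sup>2 * norm w)"
      by (simp add: power2_eq_square algebra_simps)
    finally show "\<bar>christoffel1 M \<kappa> p u u w\<bar> \<le> (3 * \<bar>B\<bar> + 1) * (norm u)\<^sup>2 * norm w" by (simp add: mult.assoc)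
  qed simp
qed

text \<open>The product rule for the coefficient expansion, \<open>v\<close> being a vector field
  along the curve \<open>u\<close>. When \<open>v\<close> is the velocity, the derivative is twice
  the left side of the geodesic equation tested against the velocity.\<close>

lemma metric_along_curve_deriv:
  assumes "\<kappa> \<in> atlas M" "u t \<in> chart_map \<kappa> ` chart_dom \<kappa>" "t \<in> I"
    "(u has_vector_derivative u1) (at t within I)" "(v has_vector_derivative v1) (at t within I)"
  shows "((\<lambda>s. metric_coord M \<kappa> (u s) (v s) (v s)) has_real_derivative
     metric_deriv \<kappa> (u t) (v t) (v t) u1 + 2 * metric_coord M \<kappa> (u t) v1 (v t)) (at t within I)"
proof -
  let ?g = "\<lambda>p. metric_coord M \<kappa> p"
  have g: "((\<lambda>s. ?g (u s) i j) has_real_derivative metric_deriv \<kappa> (u t) i j u1) (at t within I)" for i j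
    using vector_derivative_diff_chain_within[OF assms(4) has_derivative_at_withinI[OF metric_coord_deriv[OF assms(1,2)]]]
    by (simp add: o_def has_real_derivative_iff_has_vector_derivative)
  have v: "((\<lambda>s. v s \<bullet> i) has_real_derivative v1 \<bullet> i) (at t within I)" for i
    using assms(5) unfolding has_real_derivative_iff_has_vector_derivative
    by (rule bounded_linear.has_vector_derivative[OF bounded_linear_inner_left])
  have "((\<lambda>s. \<Sum>i\<in>Basis. \<Sum>j\<in>Basis. (v s \<bullet> i) * (v s \<bullet> j) * ?g (u s) i j) has_real_derivative
    (\<Sum>i\<in>Basis. \<Sum>j\<in>Basis. ((v1 \<bullet> i) * (v t \<bullet> j) + (v1 \<bullet> j) * (v t \<bullet> i)) * ?g (u t) i j
        + metric_deriv \<kappa> (u t) i j u1 * ((v t \<bullet> i) * (v t \<bullet> j)))) (at t within I)"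
    by (intro DERIV_sum DERIV_mult g v)
  also have "(\<Sum>i\<in>Basis. \<Sum>j\<in>Basis. ((v1 \<bullet> i) * (v t \<bullet> j) + (v1 \<bullet> j) * (v t \<bullet> i)) * ?g (u t) i j
        + metric_deriv \<kappa> (u t) i j u1 * ((v t \<bullet> i) * (v t \<bullet> j)))
     = (\<Sum>i\<in>Basis. \<Sum>j\<in>Basis. (v1 \<bullet> i) * (v t \<bullet> j) * ?g (u t) i j)
       + (\<Sum>i\<in>Basis. \<Sum>j\<in>Basis. (v t \<bullet> i) * (v1 \<bullet> j) * ?g (u t) i j)
       + (\<Sum>i\<in>Basis. \<Sum>j\<in>Basis. (v t \<bullet> i) * (v t \<bullet> j) * metric_deriv \<kappa> (u t) i j u1)"
    by (simp add: sum.distrib algebra_simps)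
  also have "\<dots> = ?g (u t) v1 (v t) + ?g (u t) (v t) v1 + metric_deriv \<kappa> (u t) (v t) (v t) u1"
    by (simp only: metric_coord_expand[OF assms(1,2), of v1 "v t"] metric_coord_expand[OF assms(1,2), of "v t" v1]
        metric_deriv_expand[OF assms(1,2), of "v t" "v t"])
  also have "\<dots> = metric_deriv \<kappa> (u t) (v t) (v t) u1 + 2 * ?g (u t) v1 (v t)"
    using metric_coord_props(2)[OF assms(1,2), of v1 "v t"] by simp
  finally have d: "((\<lambda>s. \<Sum>i\<in>Basis. \<Sum>j\<in>Basis. (v s \<bullet> i) * (v s \<bullet> j) * ?g (u s) i j) has_real_derivative
    metric_deriv \<kappa> (u t) (v t) (v t) u1 + 2 * ?g (u t) v1 (v t)) (at t within I)" .
  \<comment> \<open>The expansion holds over the chart image only; continuity keeps nearby curve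
    points there.\<close>
  have "continuous (at t within I) u"
    using assms(4) has_vector_derivative_continuous by blast
  then have "\<forall>\<^sub>F s in at t within I. u s \<in> chart_map \<kappa> ` chart_dom \<kappa>"
    using assms(2) Ck_chartD(2)[OF atlas_chart[OF assms(1), of 1]]
    by (simp add: continuous_within topological_tendstoD)
  then have "\<forall>\<^sub>F s in at t within I. (\<Sum>i\<in>Basis. \<Sum>j\<in>Basis. (v s \<bullet> i) * (v s \<bullet> j) * ?g (u s) i j) = ?g (u s) (v s) (v s)"
    by eventually_elim (rule metric_coord_expand[OF assms(1), symmetric])
  with d show ?thesis
    unfolding has_field_derivative_def
    by (rule has_derivative_transform_eventually)
      (use metric_coord_expand[OF assms(1,2), symmetric] assms(3) in simp_all)
qed

end

subsection \<open>Geodesics and distance in coordinates\<close>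

lemma vector_derivative_bound:
  fixes f :: "real \<Rightarrow> 'b::real_normed_vector"
  assumes "\<And>t. t \<in> {a..b} \<Longrightarrow> (f has_vector_derivative f' t) (at t within {a..b})"
    and "\<And>t. t \<in> {a..b} \<Longrightarrow> norm (f' t) \<le> B" and "a \<le> b"
  shows "norm (f b - f a) \<le> B * (b - a)"
proof -
  have "0 \<le> B" using order_trans[OF norm_ge_zero assms(2)[of a]] assms(3) by simp
  then have "norm (f b - f a) \<le> B * norm (b - a)"
    using assms(1-3)
    by (intro differentiable_bound[of "{a..b}" f "\<lambda>t h. h *\<^sub>R f' t"] onorm_bound)
      (auto simp: has_vector_derivative_def mult.commute[of B] intro: mult_left_mono)
  then show ?thesis using assms(3) by simp
qed

lemma at_within_Icc_neq_bot: "(a::real) < b \<Longrightarrow> t \<in> {a..b} \<Longrightarrow> at t within {a..b} \<noteq> bot"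
  using trivial_limit_within[of t "{a..b}"] by (simp del: islimpt_Icc add: islimpt_Icc)

context riem
begin

text \<open>With all three arguments equal to \<open>u'\<close>, the Koszul expression is half the
  derivative of the metric along \<open>u'\<close>, so the geodesic equation tested against
  \<open>u'\<close> makes the derivative of the squared speed vanish. Over unit time the length is
  then the speed.\<close>

lemma geodesic_constant_speed:
  assumes "geodesic M c"
  obtains s where "s \<ge> 0" "curve_length M c = s"
    "\<And>t. t \<in> {0..1} \<Longrightarrow> metric M (c t) (velocity M {0..1} c t) (velocity M {0..1} c t) = s\<^sup>2"
proof -
  let ?I = "{0..1::real}"
  let ?E = "\<lambda>t. metric M (c t) (velocity M ?I c t) (velocity M ?I c t)"
  have cc: "continuous_on ?I c" using assms by (auto simp: geodesic_def)
  have "(?E has_derivative (\<lambda>h. 0)) (at t within ?I)" if t: "t \<in> ?I" for t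
  proof -
    let ?k = "chart_at M (c t)"
    have k: "?k \<in> atlas M" "c t \<in> chart_dom ?k" by (rule chart_at)+
    obtain u' u'' where u: "\<And>s. s \<in> ?I \<Longrightarrow> c s \<in> chart_dom ?k \<Longrightarrow>
        ((\<lambda>s. chart_map ?k (c s)) has_vector_derivative u' s) (at s within ?I) \<and>
        (u' has_vector_derivative u'' s) (at s within ?I) \<and>
        (\<forall>w. metric_coord M ?k (chart_map ?k (c s)) (u'' s) w
             + christoffel1 M ?k (chart_map ?k (c s)) (u' s) (u' s) w = 0)"
      using assms k(1) unfolding geodesic_def by blast
    let ?g = "\<lambda>s. metric_coord M ?k (chart_map ?k (c s)) (u' s) (u' s)"
    have E: "?E s = ?g s" if "s \<in> ?I" "c s \<in> chart_dom ?k" for s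
    proof -
      have "velocity M ?I c s = tangent_of_coord M ?k (c s) (u' s)"
        using cc that u[OF that] k at_within_Icc_neq_bot[of 0 1 s]
        by (intro velocity_eq) (auto simp: continuous_on_eq_continuous_within)
      then show ?thesis by (simp add: metric_coord_eq[OF k(1) that(2)])
    qed
    have d: "(?g has_real_derivative
      metric_deriv ?k (chart_map ?k (c t)) (u' t) (u' t) (u' t)
        + 2 * metric_coord M ?k (chart_map ?k (c t)) (u'' t) (u' t)) (at t within ?I)"
      using u[OF t k(2)] k t by (intro metric_along_curve_deriv) auto
    have "metric_coord M ?k (chart_map ?k (c t)) (u'' t) (u' t)
             + christoffel1 M ?k (chart_map ?k (c t)) (u' t) (u' t) (u' t) = 0"
      using u[OF t k(2)] by blast
    then have "metric_deriv ?k (chart_map ?k (c t)) (u' t) (u' t) (u' t)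
        + 2 * metric_coord M ?k (chart_map ?k (c t)) (u'' t) (u' t) = 0"
      by (simp add: christoffel1_def)
    with d have "(?g has_derivative (\<lambda>h. 0)) (at t within ?I)"
      by (simp add: has_field_derivative_def lambda_zero)
    moreover have "\<forall>\<^sub>F s in at t within ?I. c s \<in> chart_dom ?k"
      using cc t k(2) topological_tendstoD[OF _ Ck_chartD(1)[OF atlas_chart[OF k(1), of 1]]]
      unfolding continuous_on_def by blast
    then have "\<forall>\<^sub>F s in at t within ?I. ?g s = ?E s"
      unfolding eventually_at_filter
      by eventually_elim (use E in auto)
    ultimately show ?thesis
      by (rule has_derivative_transform_eventually) (use E[OF t k(2)] t in auto)
  qed
  \<comment> \<open>Each zero derivative was found in the chart around its own \<open>c t\<close>;
    constancy on the interval requires no common chart.\<close>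
  then obtain E0 where E0: "\<And>t. t \<in> ?I \<Longrightarrow> ?E t = E0"
    using has_derivative_zero_constant[of ?I ?E] by auto
  have "E0 \<ge> 0"
    using E0[of 0] metric_props(3)[of "velocity M ?I c 0" "c 0"] bilinear_lzero[OF metric_props(1)]
    by (cases "velocity M ?I c 0 = 0") auto
  show ?thesis
  proof (rule that[of "sqrt E0"])
    show "sqrt E0 \<ge> 0" using \<open>E0 \<ge> 0\<close> by simp
    have "curve_length M c = integral ?I (\<lambda>t. sqrt E0)"
      unfolding curve_length_def tnorm_def by (rule integral_cong) (use E0 in simp)
    then show "curve_length M c = sqrt E0" by simp
    show "?E t = (sqrt E0)\<^sup>2" if "t \<in> ?I" for t
      using E0[OF that] \<open>E0 \<ge> 0\<close> by simp
  qed
qed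

section \<open>Comparison of distance and coordinate difference\<close>

lemma curve_length_nonneg: "curve_length M c \<ge> 0"
proof -
  have "tnorm M z w \<ge> 0" for z w
    using metric_props(3)[of w z] bilinear_lzero[OF metric_props(1), of z w]
    by (cases "w = 0") (auto simp: tnorm_def)
  then show ?thesis unfolding curve_length_def
    \<comment> \<open>The integral of a non-integrable function is 0 by convention, which covers
      arbitrary \<open>c\<close>.\<close>
    by (cases "(\<lambda>t. tnorm M (c t) (velocity M {0..1} c t)) integrable_on {0..1}")
      (auto simp: not_integrable_integral intro!: Henstock_Kurzweil_Integration.integral_nonneg)
qed

lemma riem_dist_le_length:
  assumes "piecewise_C1_path M c" "c 0 = x" "c 1 = y"
  shows "riem_dist M x y \<le> curve_length M c"
  unfolding riem_dist_def
  by (rule cInf_lower) (use assms curve_length_nonneg in \<open>auto intro!: bdd_belowI[of _ 0]\<close>)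

text \<open>\<open>C1_curve\<close> demands a derivative in every chart of the atlas, so the segment
  is pushed through each transition map.\<close>

lemma coordinate_line_C1:
  assumes "\<kappa> \<in> atlas M" "\<And>t. t \<in> {0..1} \<Longrightarrow> p + t *\<^sub>R v \<in> chart_map \<kappa> ` chart_dom \<kappa>"
  shows "C1_curve M {0..1} (\<lambda>t. chart_inv \<kappa> (p + t *\<^sub>R v))"
proof -
  note k = Ck_chartD[OF atlas_chart[OF assms(1), of 1]]
  let ?l = "\<lambda>t::real. p + t *\<^sub>R v"
  have l: "continuous_on A ?l" for A by (intro continuous_intros)
  have "\<exists>D. continuous_on {t\<in>{0..1}. chart_inv \<kappa> (?l t) \<in> chart_dom \<kappa>'} D \<and>
        (\<forall>t\<in>{0..1}. chart_inv \<kappa> (?l t) \<in> chart_dom \<kappa>' \<longrightarrow>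
           ((\<lambda>s. chart_map \<kappa>' (chart_inv \<kappa> (?l s))) has_vector_derivative D t) (at t within {0..1}))"
    if k': "\<kappa>' \<in> atlas M" for \<kappa>'
  proof (intro exI conjI ballI impI)
    let ?F = "chart_map \<kappa>' \<circ> chart_inv \<kappa>"
    let ?O = "chart_map \<kappa> ` (chart_dom \<kappa> \<inter> chart_dom \<kappa>')"
    let ?D = "\<lambda>t. frechet_derivative ?F (at (?l t)) v"
    have C: "Ck_on (Suc 0) ?F ?O" by (rule transition_Ck[OF atlas_chart[OF assms(1)] k'])
    have in_O: "?l t \<in> ?O" if "t \<in> {0..1}" "chart_inv \<kappa> (?l t) \<in> chart_dom \<kappa>'" for t
      using k(5,6)[OF assms(2)[OF that(1)]] that(2) by (metis IntI image_eqI)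
    have "continuous_on ?O (\<lambda>q. frechet_derivative ?F (at q) v)"
      using C by simp
    then show "continuous_on {t\<in>{0..1}. chart_inv \<kappa> (?l t) \<in> chart_dom \<kappa>'} ?D"
      by (rule continuous_on_compose2[OF _ l]) (use in_O in auto)
    fix t assume t: "t \<in> {0..1::real}" "chart_inv \<kappa> (?l t) \<in> chart_dom \<kappa>'"
    have "(?F has_derivative frechet_derivative ?F (at (?l t))) (at (?l t))"
      using Ck_on_differentiable[OF C _ in_O[OF t]] by (simp add: frechet_derivative_works[symmetric])
    moreover have "(?l has_vector_derivative v) (at t within {0..1})"
      by (auto intro!: derivative_eq_intros)
    ultimately have "((?F \<circ> ?l) has_vector_derivative ?D t) (at t within {0..1})"
      using vector_derivative_diff_chain_within has_derivative_at_withinI by blast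
    then show "((\<lambda>s. chart_map \<kappa>' (chart_inv \<kappa> (?l s))) has_vector_derivative ?D t) (at t within {0..1})"
      by (simp add: o_def)
  qed
  moreover have "continuous_on {0..1} (\<lambda>t. chart_inv \<kappa> (?l t))"
    by (rule continuous_on_compose2[OF k(8) l]) (use assms in auto)
  ultimately show ?thesis unfolding C1_curve_def by blast
qed

text \<open>The coordinate segment from \<open>x\<close> to \<open>y\<close> stays in a compact
  ball, where the metric has an upper bound \<open>C0\<close>; its length, at most
  \<open>sqrt C0\<close> times its coordinate length, dominates the infimum.\<close>

lemma riem_dist_le_coordinate_dist:
  assumes "\<rho> > 0" "cball (chart_map (chart_at M x) x) \<rho> \<subseteq> chart_map (chart_at M x) ` chart_dom (chart_at M x)"
  obtains C where "C > 0"
    "\<And>y. y \<in> chart_dom (chart_at M x) \<Longrightarrow>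
       norm (chart_map (chart_at M x) y - chart_map (chart_at M x) x) < \<rho> \<Longrightarrow>
       riem_dist M x y \<le> C * norm (chart_map (chart_at M x) y - chart_map (chart_at M x) x)"
proof -
  let ?k = "chart_at M x"
  let ?p = "chart_map ?k x"
  have at: "?k \<in> atlas M" by (rule chart_at)
  note k = Ck_chartD[OF atlas_chart[OF at, of 1]]
  obtain c0 C0 where C0: "C0 > 0" "\<And>p u. p \<in> cball ?p \<rho> \<Longrightarrow> metric_coord M ?k p u u \<le> C0 * (norm u)\<^sup>2"
    using metric_coord_bounds[OF at compact_cball assms(2)] by metis
  show ?thesis
  proof (rule that[of "sqrt C0"])
    show "sqrt C0 > 0" using C0 by simp
    fix y assume y: "y \<in> chart_dom ?k" "norm (chart_map ?k y - ?p) < \<rho>"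
    define v where "v = chart_map ?k y - ?p"
    let ?c = "\<lambda>t. chart_inv ?k (?p + t *\<^sub>R v)"
    have b: "?p + t *\<^sub>R v \<in> cball ?p \<rho>" if "t \<in> {0..1}" for t
    proof -
      have "\<bar>t\<bar> * norm v \<le> 1 * norm v" using that by (intro mult_right_mono) auto
      then show ?thesis using y that by (simp add: dist_norm v_def[symmetric])
    qed
    then have b2: "?p + t *\<^sub>R v \<in> chart_map ?k ` chart_dom ?k" if "t \<in> {0..1}" for t
      using assms(2) that by blast
    have C1: "C1_curve M {0..1} ?c" by (rule coordinate_line_C1[OF at b2])
    then have cont: "continuous_on {0..1} ?c" by (simp add: C1_curve_def)
    have "piecewise_C1_path M ?c"
      unfolding piecewise_C1_path_def by (rule exI[of _ "{0,1}"]) (use C1 in auto)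
    then have "riem_dist M x y \<le> curve_length M ?c"
      by (rule riem_dist_le_length) (use k(4) y chart_at in \<open>auto simp: v_def\<close>)
    also have "\<dots> = integral {0..1} (\<lambda>t. sqrt (metric_coord M ?k (?p + t *\<^sub>R v) v v))"
      unfolding curve_length_def
    proof (rule integral_cong)
      fix t :: real assume t: "t \<in> {0..1}"
      have "((\<lambda>s. ?p + s *\<^sub>R v) has_vector_derivative v) (at t within {0..1})"
        by (auto intro!: derivative_eq_intros)
      then have d: "((\<lambda>s. chart_map ?k (?c s)) has_vector_derivative v) (at t within {0..1})"
        by (rule has_vector_derivative_transform[rotated 2]) (use t b2 k(5) in auto)
      have "velocity M {0..1} ?c t = tangent_of_coord M ?k (?c t) v"
        by (rule velocity_eq[OF at _ _ t d])
          (use t b2 k(6) cont at_within_Icc_neq_bot[of 0 1 t] in \<open>auto simp: continuous_on_eq_continuous_within\<close>)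
      then show "tnorm M (?c t) (velocity M {0..1} ?c t) = sqrt (metric_coord M ?k (?p + t *\<^sub>R v) v v)"
        using metric_coord_eq[OF at k(6)[OF b2[OF t]], of v v] k(5)[OF b2[OF t]] by (simp add: tnorm_def)
    qed
    also have "\<dots> \<le> integral {0..1} (\<lambda>t::real. sqrt C0 * norm v)"
    proof (rule Henstock_Kurzweil_Integration.integral_le)
      have "continuous_on {0..1} (\<lambda>t. metric_coord M ?k (?p + t *\<^sub>R v) v v)"
        by (rule continuous_on_compose2[OF metric_coord_continuous[OF at]])
          (use b2 in \<open>auto intro!: continuous_intros\<close>)
      then show "(\<lambda>t. sqrt (metric_coord M ?k (?p + t *\<^sub>R v) v v)) integrable_on {0..1}"
        by (intro integrable_continuous_interval continuous_on_real_sqrt)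
      show "sqrt (metric_coord M ?k (?p + t *\<^sub>R v) v v) \<le> sqrt C0 * norm v" if "t \<in> {0..1}" for t
        using real_sqrt_le_mono[OF C0(2)[OF b[OF that], of v]] by (simp add: real_sqrt_mult)
    qed (simp add: integrable_const_ivl)
    finally show "riem_dist M x y \<le> sqrt C0 * norm (chart_map ?k y - ?p)" by (simp add: v_def)
  qed
qed

text \<open>A bounded coordinate speed keeps a short geodesic in the ball; there the geodesic
  equation bounds its acceleration, so over unit time it departs from its tangent line by a
  quadratic amount only.\<close>

lemma short_geodesic_in_chart:
  assumes "\<rho> > 0" "cball (chart_map (chart_at M x) x) \<rho> \<subseteq> chart_map (chart_at M x) ` chart_dom (chart_at M x)"
  obtains \<delta> C where "\<delta> > 0" "C > 0"
    "\<And>c. geodesic M c \<Longrightarrow> c 0 = x \<Longrightarrow> curve_length M c < \<delta> \<Longrightarrow>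
      c 1 \<in> chart_dom (chart_at M x) \<and>
      norm (chart_map (chart_at M x) (c 1) - chart_map (chart_at M x) x) \<le> C * curve_length M c \<and>
      norm (chart_map (chart_at M x) (c 1) - chart_map (chart_at M x) x - velocity M {0..1} c 0)
        \<le> C * (curve_length M c)\<^sup>2"
proof -
  let ?k = "chart_at M x"
  let ?p = "chart_map ?k x"
  let ?I = "{0..1::real}"
  have at: "?k \<in> atlas M" "x \<in> chart_dom ?k" by (rule chart_at)+
  note k = Ck_chartD[OF atlas_chart[OF at(1), of 1]]
  obtain c0 C0 where c0: "c0 > 0" "\<And>p u. p \<in> cball ?p \<rho> \<Longrightarrow> c0 * (norm u)\<^sup>2 \<le> metric_coord M ?k p u u"
    using metric_coord_bounds[OF at(1) compact_cball assms(2)] by metis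
  obtain C1 where C1: "C1 > 0"
    "\<And>p u w. p \<in> cball ?p \<rho> \<Longrightarrow> \<bar>christoffel1 M ?k p u u w\<bar> \<le> C1 * (norm u)\<^sup>2 * norm w"
    using christoffel_bound[OF at(1) compact_cball assms(2)] by metis
  \<comment> \<open>Speed \<open>s\<close> and the lower metric bound \<open>c0\<close> give
    coordinate speed at most \<open>s / sqrt c0\<close>. The constant \<open>C\<close> below also
    dominates the acceleration constant, so that it serves both conclusions.\<close>
  define A where "A = 1 / sqrt c0"
  have A: "A > 0" using c0 by (simp add: A_def)
  define C where "C = max A (C1 * A\<^sup>2 / c0)"
  show ?thesis
  \<comment> \<open>Length below \<open>\<rho> / A\<close> means \<open>A * s < \<rho>\<close>: too
    slow to reach the edge of the ball in unit time.\<close>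
  proof (rule that[of "\<rho> / A" C])
    show "\<rho> / A > 0" "C > 0" using A assms(1) by (auto simp: C_def)
    fix c assume geo: "geodesic M c" and c0x: "c 0 = x" and len: "curve_length M c < \<rho> / A"
    obtain s where s: "s \<ge> 0" "curve_length M c = s"
      "\<And>t. t \<in> ?I \<Longrightarrow> metric M (c t) (velocity M ?I c t) (velocity M ?I c t) = s\<^sup>2"
      using geodesic_constant_speed[OF geo] by blast
    have small: "A * s < \<rho>" using len s A by (simp add: field_simps)
    have cc: "continuous_on ?I c" using geo by (auto simp: geodesic_def)
    obtain u' u'' where u: "\<And>t. t \<in> ?I \<Longrightarrow> c t \<in> chart_dom ?k \<Longrightarrow>
        ((\<lambda>s. chart_map ?k (c s)) has_vector_derivative u' t) (at t within ?I) \<and>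
        (u' has_vector_derivative u'' t) (at t within ?I) \<and>
        (\<forall>w. metric_coord M ?k (chart_map ?k (c t)) (u'' t) w
             + christoffel1 M ?k (chart_map ?k (c t)) (u' t) (u' t) w = 0)"
      using geo at(1) unfolding geodesic_def by blast
    define W where "W = chart_inv ?k ` ball ?p \<rho>"
    have sub: "ball ?p \<rho> \<subseteq> chart_map ?k ` chart_dom ?k" using assms(2) ball_subset_cball by blast
    have openW: "open W" unfolding W_def by (rule Ck_chart_open_inv_image[OF atlas_chart[OF at(1), of 1] open_ball sub])
    have W_iff: "z \<in> W \<longleftrightarrow> z \<in> chart_dom ?k \<and> chart_map ?k z \<in> ball ?p \<rho>" for z
    proof
      show "z \<in> W \<Longrightarrow> z \<in> chart_dom ?k \<and> chart_map ?k z \<in> ball ?p \<rho>"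
        unfolding W_def using sub k(5,6) by auto
      show "z \<in> chart_dom ?k \<and> chart_map ?k z \<in> ball ?p \<rho> \<Longrightarrow> z \<in> W"
        unfolding W_def using k(4) by (metis image_eqI)
    qed
    have u'_bound: "norm (u' t) \<le> A * s" if t: "t \<in> ?I" "c t \<in> W" for t
    proof -
      have W: "c t \<in> chart_dom ?k" "chart_map ?k (c t) \<in> cball ?p \<rho>" using t W_iff[of "c t"] by auto
      have "velocity M ?I c t = tangent_of_coord M ?k (c t) (u' t)"
        using cc W u[OF t(1) W(1)] at(1) at_within_Icc_neq_bot[of 0 1 t] t
        by (intro velocity_eq) (auto simp: continuous_on_eq_continuous_within)
      then have "metric_coord M ?k (chart_map ?k (c t)) (u' t) (u' t) = s\<^sup>2"
        using s(3)[OF t(1)] by (simp add: metric_coord_eq[OF at(1) W(1)])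
      then have "c0 * (norm (u' t))\<^sup>2 \<le> s\<^sup>2" using c0(2)[OF W(2), of "u' t"] by simp
      then have "(sqrt c0 * norm (u' t))\<^sup>2 \<le> s\<^sup>2" using c0 by (simp add: power_mult_distrib)
      then have "sqrt c0 * norm (u' t) \<le> s" using s(1) by (rule power2_le_imp_le)
      then show ?thesis using c0(1) by (simp add: A_def field_simps)
    qed
    \<comment> \<open>Confinement is assumed only up to \<open>r\<close>, so the estimate is
      available before the geodesic is known to stay in \<open>W\<close>, and again afterwards with
      \<open>r = 1\<close>.\<close>
    have u_bound: "norm (chart_map ?k (c r) - ?p) \<le> A * s" if r: "r \<in> ?I" "\<And>t. t \<in> {0..r} \<Longrightarrow> c t \<in> W" for r
    proof -
      have "norm (chart_map ?k (c r) - chart_map ?k (c 0)) \<le> A * s * (r - 0)"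
      proof (rule vector_derivative_bound[where f'=u'])
        fix t assume t: "t \<in> {0..r}"
        then have "c t \<in> W" "t \<in> ?I" using r by auto
        then show "norm (u' t) \<le> A * s" using u'_bound by blast
        show "((\<lambda>s. chart_map ?k (c s)) has_vector_derivative u' t) (at t within {0..r})"
          by (rule has_vector_derivative_within_subset[of _ _ _ ?I])
            (use u[OF \<open>t \<in> ?I\<close>] \<open>c t \<in> W\<close> W_iff r in auto)
      qed (use r in auto)
      also have "\<dots> \<le> A * s * 1" using r A s by (intro mult_left_mono) auto
      finally show ?thesis by (simp add: c0x)
    qed
    \<comment> \<open>At the first exit time \<open>T\<close> from \<open>W\<close>, the speed bound on \<open>[0,T)\<close> still keeps \<open>c\<close> in the compact
      set \<open>K\<close>, which is closed as \<open>'m\<close> is Hausdorff; coordinates cannot be used at \<open>T\<close> itself.\<close>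
    have inW: "c t \<in> W" if "t \<in> ?I" for t
    proof (rule ccontr)
      assume neg: "c t \<notin> W"
      let ?B = "?I \<inter> c -` (- W)"
      have "closed ?B" by (rule continuous_closed_preimage[OF cc]) (use openW in auto)
      moreover have "bounded ?B" by (rule bounded_subset[of ?I]) auto
      ultimately have "compact ?B" using compact_eq_bounded_closed by blast
      moreover have "?B \<noteq> {}" using that neg by blast
      ultimately obtain T where T: "T \<in> ?B" "\<And>r. r \<in> ?B \<Longrightarrow> T \<le> r"
        using compact_attains_inf by metis
      have W0: "c 0 \<in> W" using W_iff[of x] at assms(1) c0x by simp
      have T0: "T > 0" using T(1) W0 by (cases "T = 0") auto
      define K where "K = chart_inv ?k ` cball ?p (A * s)"
      have Ksub: "cball ?p (A * s) \<subseteq> ball ?p \<rho>" using small by auto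
      have "compact K" unfolding K_def
        by (rule compact_continuous_image[OF continuous_on_subset[OF k(8)]]) (use Ksub sub in auto)
      then have "closed K" by (rule compact_imp_closed)
      have cT: "continuous_on {0..T} c" by (rule continuous_on_subset[OF cc]) (use T in auto)
      have "c r \<in> K" if r: "r \<in> {0..<T}" for r
      proof -
        have w: "c t \<in> W" if "t \<in> {0..r}" for t
          using T(2)[of t] T(1) r that by force
        have "norm (chart_map ?k (c r) - ?p) \<le> A * s"
          by (rule u_bound) (use r T w in auto)
        moreover have "c r \<in> chart_dom ?k" using w[of r] r W_iff by auto
        ultimately show ?thesis unfolding K_def
          using k(4) by (intro image_eqI[of _ _ "chart_map ?k (c r)"]) (auto simp: dist_norm norm_minus_commute)
      qed
      then have "{0..<T} \<subseteq> {0..T} \<inter> c -` K" by auto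
      then have "closure {0..<T} \<subseteq> {0..T} \<inter> c -` K"
        using continuous_closed_preimage[OF cT _ \<open>closed K\<close>] by (intro closure_minimal) auto
      then have "c T \<in> K" using T0 by (auto simp: subset_iff)
      then have "c T \<in> W" unfolding K_def W_def using Ksub by blast
      then show False using T(1) by auto
    qed
    have uk: "c t \<in> chart_dom ?k" "chart_map ?k (c t) \<in> cball ?p \<rho>" if "t \<in> ?I" for t
      using inW[OF that] W_iff by auto
    \<comment> \<open>The geodesic equation is tested against the acceleration itself, and one
      factor \<open>norm (u'' t)\<close> cancels.\<close>
    have u''_bound: "norm (u'' t) \<le> C1 * A\<^sup>2 / c0 * s\<^sup>2" if t: "t \<in> ?I" for t
    proof -
      let ?q = "chart_map ?k (c t)"
      have "c0 * (norm (u'' t))\<^sup>2 \<le> metric_coord M ?k ?q (u'' t) (u'' t)"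
        by (rule c0(2)[OF uk(2)[OF t]])
      also have "metric_coord M ?k ?q (u'' t) (u'' t) = - christoffel1 M ?k ?q (u' t) (u' t) (u'' t)"
        using u[OF t uk(1)[OF t]] by (simp add: eq_neg_iff_add_eq_0)
      also have "\<dots> \<le> C1 * (norm (u' t))\<^sup>2 * norm (u'' t)"
        using C1(2)[OF uk(2)[OF t], of "u' t" "u'' t"] by linarith
      also have "\<dots> \<le> C1 * (A * s)\<^sup>2 * norm (u'' t)"
        using u'_bound[OF t inW[OF t]] C1 by (intro mult_right_mono mult_left_mono power_mono) auto
      finally have "c0 * norm (u'' t) * norm (u'' t) \<le> C1 * (A * s)\<^sup>2 * norm (u'' t)"
        by (simp add: power2_eq_square mult.assoc)
      then have "c0 * norm (u'' t) \<le> C1 * (A * s)\<^sup>2" using C1(1)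
        by (cases "u'' t = 0") (auto dest: mult_right_le_imp_le)
      then show ?thesis using c0(1) by (simp add: field_simps power_mult_distrib)
    qed
    have u'_dev: "norm (u' r - u' 0) \<le> C1 * A\<^sup>2 / c0 * s\<^sup>2" if r: "r \<in> ?I" for r
    proof -
      have "norm (u' r - u' 0) \<le> C1 * A\<^sup>2 / c0 * s\<^sup>2 * (r - 0)"
      proof (rule vector_derivative_bound[where f'=u''])
        fix t assume t: "t \<in> {0..r}"
        then have "t \<in> ?I" using r by auto
        then show "norm (u'' t) \<le> C1 * A\<^sup>2 / c0 * s\<^sup>2" by (rule u''_bound)
        show "(u' has_vector_derivative u'' t) (at t within {0..r})"
          by (rule has_vector_derivative_within_subset[of _ _ _ ?I])
            (use u[OF \<open>t \<in> ?I\<close>] uk[OF \<open>t \<in> ?I\<close>] r in auto)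
      qed (use r in auto)
      also have "\<dots> \<le> C1 * A\<^sup>2 / c0 * s\<^sup>2 * 1" using r C1 c0 by (intro mult_left_mono) auto
      finally show ?thesis by simp
    qed
    \<comment> \<open>This chart is the preferred chart of \<open>c 0\<close>, so the initial
      velocity is the coordinate derivative, without a transition.\<close>
    have v0: "velocity M ?I c 0 = u' 0"
      unfolding velocity_def c0x
      by (rule vector_derivative_within) (use u[of 0] uk[of 0] at_within_Icc_neq_bot[of 0 1 0] in auto)
    have "norm (chart_map ?k (c 1) - chart_map ?k (c 0) - (1 - 0) *\<^sub>R u' 0) \<le> norm (1 - 0 :: real) * (C1 * A\<^sup>2 / c0 * s\<^sup>2)"
      by (rule vector_differentiable_bound_linearization[of ?I])
        (use u uk u'_dev closed_segment_eq_real_ivl[of 0 1] in auto)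
    then have 2: "norm (chart_map ?k (c 1) - ?p - velocity M ?I c 0) \<le> C1 * A\<^sup>2 / c0 * s\<^sup>2"
      by (simp add: v0 c0x)
    have 1: "norm (chart_map ?k (c 1) - ?p) \<le> A * s" by (rule u_bound) (use inW in auto)
    have "A \<le> C" "C1 * A\<^sup>2 / c0 \<le> C" by (simp_all add: C_def)
    then have "A * s \<le> C * s" "C1 * A\<^sup>2 / c0 * s\<^sup>2 \<le> C * s\<^sup>2"
      using s(1) zero_le_power2[of s] mult_right_mono by blast+
    then show "c 1 \<in> chart_dom ?k \<and>
      norm (chart_map ?k (c 1) - ?p) \<le> C * curve_length M c \<and>
      norm (chart_map ?k (c 1) - ?p - velocity M ?I c 0) \<le> C * (curve_length M c)\<^sup>2"
      using 1 2 uk[of 1] s(2) by auto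
  qed
qed

text \<open>Injectivity of the chart is the point: coordinates close to those of \<open>x\<close>
  come from some point of \<open>W\<close>, which must then be \<open>y\<close>. The closed ball
  serves later compactness arguments.\<close>

lemma chart_nbhd:
  assumes "open W" "x \<in> W" "Ck_chart M r \<kappa>" "x \<in> chart_dom \<kappa>"
  obtains \<rho> where "\<rho> > 0" "cball (chart_map \<kappa> x) \<rho> \<subseteq> chart_map \<kappa> ` chart_dom \<kappa>"
    "\<And>y. y \<in> chart_dom \<kappa> \<Longrightarrow> norm (chart_map \<kappa> y - chart_map \<kappa> x) \<le> \<rho> \<Longrightarrow> y \<in> W"
proof -
  let ?O = "chart_map \<kappa> ` (chart_dom \<kappa> \<inter> W)"
  have "open ?O" by (rule Ck_chart_open_image[OF assms(3,1)])
  then obtain \<rho> where r: "\<rho> > 0" "cball (chart_map \<kappa> x) \<rho> \<subseteq> ?O"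
    using assms(2,4) open_contains_cball by (metis IntI image_eqI)
  show ?thesis
  proof (rule that[OF r(1)])
    show "cball (chart_map \<kappa> x) \<rho> \<subseteq> chart_map \<kappa> ` chart_dom \<kappa>" using r(2) by auto
    fix y assume y: "y \<in> chart_dom \<kappa>" "norm (chart_map \<kappa> y - chart_map \<kappa> x) \<le> \<rho>"
    then have "chart_map \<kappa> y \<in> ?O" using r(2) by (auto simp: dist_norm norm_minus_commute)
    then obtain z where z: "chart_map \<kappa> y = chart_map \<kappa> z" "z \<in> chart_dom \<kappa> \<inter> W" by (rule imageE)
    have "y = chart_inv \<kappa> (chart_map \<kappa> y)" by (rule Ck_chartD(4)[OF assms(3) y(1), symmetric])
    also have "\<dots> = z" unfolding z(1) by (rule Ck_chartD(4)[OF assms(3)]) (use z(2) in blast)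
    finally show "y \<in> W" using z(2) by blast
  qed
qed

subsection \<open>Proximal normals in coordinates\<close>

text \<open>Uniqueness of the minimizing geodesic holds on \<open>{0..1}\<close> only, which
  suffices because the initial velocity is a derivative within that interval; so the description in
  \<open>exp_inv\<close> is proper.\<close>

lemma exp_inv_minimizing:
  assumes "strongly_convex M U" "x \<in> U" "y \<in> U"
  obtains c where "minimizing_geodesic M c x y" "exp_inv M x y = velocity M {0..1} c 0"
proof -
  obtain c where c: "minimizing_geodesic M c x y"
    "\<And>c' t. minimizing_geodesic M c' x y \<Longrightarrow> t \<in> {0..1} \<Longrightarrow> c' t = c t"
    using assms unfolding strongly_convex_def by metis
  have "velocity M {0..1} c' 0 = velocity M {0..1} c 0" if "minimizing_geodesic M c' x y" for c'
  proof -
    have e: "c' t = c t" if "t \<in> {0..1}" for t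
      using c(2) \<open>minimizing_geodesic M c' x y\<close> that by blast
    \<comment> \<open>\<open>vector_derivative\<close> is chosen from this predicate, so equivalent
      predicates give equal values with no appeal to existence.\<close>
    have "((\<lambda>s. f (c' s)) has_vector_derivative D) (at 0 within {0..1}) \<longleftrightarrow>
      ((\<lambda>s. f (c s)) has_vector_derivative D) (at 0 within {0..1})" for D and f :: "'m \<Rightarrow> 'e"
      using has_vector_derivative_transform[of 0 "{0..1}" "\<lambda>s. f (c s)" "\<lambda>s. f (c' s)" D]
        has_vector_derivative_transform[of 0 "{0..1}" "\<lambda>s. f (c' s)" "\<lambda>s. f (c s)" D] e
      by (metis atLeastAtMost_iff order_refl zero_le_one)
    then show ?thesis unfolding velocity_def vector_derivative_def using e[of 0] by simp
  qed
  then have "exp_inv M x y = velocity M {0..1} c 0"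
    unfolding exp_inv_def by (intro the_equality) (use c(1) in blast)+
  then show ?thesis using that c(1) by blast
qed

lemma prox_normal_coord:
  assumes "\<xi> \<in> prox_normal_cone M S x"
  obtains C \<rho> where "C \<ge> 0" "\<rho> > 0"
    "\<And>y. y \<in> S \<Longrightarrow> y \<in> chart_dom (chart_at M x) \<Longrightarrow>
      norm (chart_map (chart_at M x) y - chart_map (chart_at M x) x) < \<rho> \<Longrightarrow>
      metric M x \<xi> (chart_map (chart_at M x) y - chart_map (chart_at M x) x)
        \<le> C * (norm (chart_map (chart_at M x) y - chart_map (chart_at M x) x))\<^sup>2"
proof -
  let ?k = "chart_at M x"
  let ?p = "chart_map ?k x"
  obtain \<sigma> U where U: "\<sigma> > 0" "x \<in> interior U" "strongly_convex M U"
    "\<And>y. y \<in> U \<Longrightarrow> y \<in> S \<Longrightarrow> metric M x \<xi> (exp_inv M x y) \<le> \<sigma> * (riem_dist M x y)\<^sup>2"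
    using assms unfolding prox_normal_cone_def by auto
  obtain \<rho> where r: "\<rho> > 0" "cball ?p \<rho> \<subseteq> chart_map ?k ` chart_dom ?k"
    "\<And>y. y \<in> chart_dom ?k \<Longrightarrow> norm (chart_map ?k y - ?p) \<le> \<rho> \<Longrightarrow> y \<in> interior U"
    using chart_nbhd[OF open_interior U(2) atlas_chart[OF chart_at(1), of 1] chart_at(2)] by metis
  obtain C1 where C1: "C1 > 0" "\<And>y. y \<in> chart_dom ?k \<Longrightarrow> norm (chart_map ?k y - ?p) < \<rho> \<Longrightarrow>
       riem_dist M x y \<le> C1 * norm (chart_map ?k y - ?p)"
    using riem_dist_le_coordinate_dist[OF r(1,2)] by metis
  obtain \<delta> C2 where C2: "\<delta> > 0" "C2 > 0"
    "\<And>c. geodesic M c \<Longrightarrow> c 0 = x \<Longrightarrow> curve_length M c < \<delta> \<Longrightarrow>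
      norm (chart_map ?k (c 1) - ?p - velocity M {0..1} c 0) \<le> C2 * (curve_length M c)\<^sup>2"
    using short_geodesic_in_chart[OF r(1,2)] by metis
  obtain B where B: "B > 0" "\<And>u v. \<bar>metric M x u v\<bar> \<le> B * norm u * norm v"
    using bilinear_bounded_pos[OF metric_props(1)[of x]] by auto
  show ?thesis
  \<comment> \<open>\<open>\<sigma>\<close> bounds the pairing with \<open>exp_inv\<close>, the
    second summand the pairing with its deviation from \<open>?w\<close>, and \<open>C1\<close>
    turns distance into coordinates. The radius \<open>\<delta> / C1\<close> forces the distance
    below \<open>\<delta>\<close>.\<close>
  proof (rule that[of "(\<sigma> + B * norm \<xi> * C2) * C1\<^sup>2" "min \<rho> (\<delta> / C1)"])
    show "0 \<le> (\<sigma> + B * norm \<xi> * C2) * C1\<^sup>2" using U(1) B C2 by simp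
    show "0 < min \<rho> (\<delta> / C1)" using r C1 C2 by simp
    fix y assume y: "y \<in> S" "y \<in> chart_dom ?k" "norm (chart_map ?k y - ?p) < min \<rho> (\<delta> / C1)"
    let ?w = "chart_map ?k y - ?p"
    have "y \<in> U" "x \<in> U" using r(3)[OF y(2)] y(3) U(2) interior_subset by auto
    then obtain c where c: "minimizing_geodesic M c x y" "exp_inv M x y = velocity M {0..1} c 0"
      using exp_inv_minimizing U(3) by blast
    then have cg: "geodesic M c" "c 0 = x" "c 1 = y" "curve_length M c = riem_dist M x y"
      by (auto simp: minimizing_geodesic_def)
    let ?d = "riem_dist M x y"
    have d: "?d \<le> C1 * norm ?w" using C1(2)[OF y(2)] y(3) by simp
    also have "\<dots> < \<delta>" using y(3) C1(1) by (simp add: field_simps)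
    finally have "?d < \<delta>" .
    then have v: "norm (?w - exp_inv M x y) \<le> C2 * ?d\<^sup>2"
      using C2(3)[OF cg(1,2)] cg c(2) by simp
    have "0 \<le> ?d" using curve_length_nonneg[of c] cg(4) by simp
    then have d2: "?d\<^sup>2 \<le> C1\<^sup>2 * (norm ?w)\<^sup>2" using power_mono[OF d, of 2] by (simp add: power_mult_distrib)
    have "metric M x \<xi> ?w = metric M x \<xi> (exp_inv M x y) + metric M x \<xi> (?w - exp_inv M x y)"
      using bilinear_rsub[OF metric_props(1)] by simp
    also have "\<dots> \<le> \<sigma> * ?d\<^sup>2 + B * norm \<xi> * norm (?w - exp_inv M x y)"
      using U(4)[OF \<open>y \<in> U\<close> y(1)] B(2)[of \<xi> "?w - exp_inv M x y"] by linarith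
    also have "\<dots> \<le> \<sigma> * ?d\<^sup>2 + B * norm \<xi> * (C2 * ?d\<^sup>2)"
      using v B by (intro add_left_mono mult_left_mono) auto
    also have "\<dots> = (\<sigma> + B * norm \<xi> * C2) * ?d\<^sup>2" by (simp add: algebra_simps)
    also have "\<dots> \<le> (\<sigma> + B * norm \<xi> * C2) * (C1\<^sup>2 * (norm ?w)\<^sup>2)"
      using d2 U(1) B C2 by (intro mult_left_mono) auto
    finally show "metric M x \<xi> ?w \<le> (\<sigma> + B * norm \<xi> * C2) * C1\<^sup>2 * (norm ?w)\<^sup>2" by (simp add: mult.assoc)
  qed
qed

lemma prox_normal_coordI:
  assumes "x \<in> interior U" "strongly_convex M U" "C \<ge> 0" "\<rho> > 0"
    "\<And>y. y \<in> S \<Longrightarrow> y \<in> chart_dom (chart_at M x) \<Longrightarrow>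
      norm (chart_map (chart_at M x) y - chart_map (chart_at M x) x) < \<rho> \<Longrightarrow>
      metric M x \<xi> (chart_map (chart_at M x) y - chart_map (chart_at M x) x)
        \<le> C * (norm (chart_map (chart_at M x) y - chart_map (chart_at M x) x))\<^sup>2"
  shows "\<xi> \<in> prox_normal_cone M S x"
proof -
  let ?k = "chart_at M x"
  let ?p = "chart_map ?k x"
  obtain \<rho>0 where r: "\<rho>0 > 0" "cball ?p \<rho>0 \<subseteq> chart_map ?k ` chart_dom ?k"
    using chart_nbhd[OF open_UNIV UNIV_I atlas_chart[OF chart_at(1), of 1] chart_at(2)] by metis
  obtain \<delta> C2 where C2: "\<delta> > 0" "C2 > 0"
    "\<And>c. geodesic M c \<Longrightarrow> c 0 = x \<Longrightarrow> curve_length M c < \<delta> \<Longrightarrow>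
      c 1 \<in> chart_dom ?k \<and> norm (chart_map ?k (c 1) - ?p) \<le> C2 * curve_length M c \<and>
      norm (chart_map ?k (c 1) - ?p - velocity M {0..1} c 0) \<le> C2 * (curve_length M c)\<^sup>2"
    using short_geodesic_in_chart[OF r(1,2)] by metis
  obtain B where B: "B > 0" "\<And>u v. \<bar>metric M x u v\<bar> \<le> B * norm u * norm v"
    using bilinear_bounded_pos[OF metric_props(1)[of x]] by auto
  \<comment> \<open>The one-point compact set yields the comparison of the metric at
    \<open>x\<close> with the Euclidean norm.\<close>
  obtain c0 where c0: "c0 > 0" "\<And>u. c0 * (norm u)\<^sup>2 \<le> metric M x u u"
    using metric_coord_bounds[OF chart_at(1), of "{?p}" x] chart_at(2)[of x] metric_coord_self[of x]
    by (metis compact_sing empty_subsetI image_eqI insert_subset singletonI)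
  define \<delta>' where "\<delta>' = min \<delta> (\<rho> / C2)"
  have \<delta>': "\<delta>' > 0" using C2 assms(4) by (simp add: \<delta>'_def)
  define \<sigma>1 where "\<sigma>1 = C * C2\<^sup>2 + B * norm \<xi> * C2"
  \<comment> \<open>For \<open>y\<close> at distance at least \<open>\<delta>'\<close>, possibly
    outside the chart, the pairing is at most linear in the distance; dividing by
    \<open>\<delta>'\<close> makes the bound quadratic.\<close>
  define \<sigma>2 where "\<sigma>2 = B * norm \<xi> / (sqrt c0 * \<delta>')"
  have nn: "\<sigma>1 \<ge> 0" "\<sigma>2 \<ge> 0" using assms B C2 c0 \<delta>' by (auto simp: \<sigma>1_def \<sigma>2_def)
  \<comment> \<open>The summand 1 makes the constant strictly positive, as proximal normals
    require.\<close>
  have "metric M x \<xi> (exp_inv M x y) \<le> (\<sigma>1 + \<sigma>2 + 1) * (riem_dist M x y)\<^sup>2" if y: "y \<in> U" "y \<in> S" for y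
  proof -
    have "x \<in> U" using assms(1) interior_subset by auto
    then obtain c where c: "minimizing_geodesic M c x y" "exp_inv M x y = velocity M {0..1} c 0"
      using exp_inv_minimizing assms(2) y by blast
    then have cg: "geodesic M c" "c 0 = x" "c 1 = y" "curve_length M c = riem_dist M x y"
      by (auto simp: minimizing_geodesic_def)
    let ?d = "riem_dist M x y" and ?v = "exp_inv M x y" and ?w = "chart_map ?k y - ?p"
    have d0: "?d \<ge> 0" using curve_length_nonneg[of c] cg(4) by simp
    \<comment> \<open>Constant speed and minimality: the Riemannian norm of
      \<open>exp_inv M x y\<close> is the distance.\<close>
    have "metric M x ?v ?v = ?d\<^sup>2"
      using geodesic_constant_speed[OF cg(1)] cg(2,4) c(2) by (metis atLeastAtMost_iff order_refl zero_le_one)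
    then have "(sqrt c0 * norm ?v)\<^sup>2 \<le> ?d\<^sup>2" using c0(2)[of ?v] c0(1) by (simp add: power_mult_distrib)
    then have "sqrt c0 * norm ?v \<le> ?d" using d0 by (rule power2_le_imp_le)
    then have vd: "norm ?v \<le> ?d / sqrt c0" using c0(1) by (simp add: field_simps)
    have "metric M x \<xi> ?v \<le> \<sigma>1 * ?d\<^sup>2 \<or> metric M x \<xi> ?v \<le> \<sigma>2 * ?d\<^sup>2"
    proof (cases "?d < \<delta>'")
      case True
      then have w: "y \<in> chart_dom ?k" "norm ?w \<le> C2 * ?d" "norm (?w - ?v) \<le> C2 * ?d\<^sup>2"
        using C2(3)[OF cg(1,2)] cg c(2) by (auto simp: \<delta>'_def)
      have "C2 * ?d < \<rho>" using True C2 by (simp add: \<delta>'_def field_simps)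
      then have mw: "metric M x \<xi> ?w \<le> C * (norm ?w)\<^sup>2" using w y by (intro assms(5)) auto
      have "metric M x \<xi> ?v = metric M x \<xi> ?w - metric M x \<xi> (?w - ?v)"
        using bilinear_rsub[OF metric_props(1)] by simp
      also have "\<dots> \<le> C * (norm ?w)\<^sup>2 + B * norm \<xi> * norm (?w - ?v)"
        using mw B(2)[of \<xi> "?w - ?v"] by linarith
      also have "\<dots> \<le> C * (C2 * ?d)\<^sup>2 + B * norm \<xi> * (C2 * ?d\<^sup>2)"
        using w B assms(3) by (intro add_mono mult_left_mono power_mono) auto
      also have "\<dots> = \<sigma>1 * ?d\<^sup>2" by (simp add: \<sigma>1_def algebra_simps power_mult_distrib)
      finally show ?thesis by blast
    next
      case False
      have "metric M x \<xi> ?v \<le> B * norm \<xi> * norm ?v" using B(2)[of \<xi> ?v] by linarith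
      also have "\<dots> \<le> B * norm \<xi> * (?d / sqrt c0)" using vd B by (intro mult_left_mono) auto
      also have "\<dots> = \<sigma>2 * (\<delta>' * ?d)" using \<delta>' by (simp add: \<sigma>2_def)
      also have "\<dots> \<le> \<sigma>2 * ?d\<^sup>2"
        using False d0 nn by (intro mult_left_mono) (auto simp: power2_eq_square intro: mult_right_mono)
      finally show ?thesis by blast
    qed
    moreover have "\<sigma>1 * ?d\<^sup>2 \<le> (\<sigma>1 + \<sigma>2 + 1) * ?d\<^sup>2" "\<sigma>2 * ?d\<^sup>2 \<le> (\<sigma>1 + \<sigma>2 + 1) * ?d\<^sup>2"
      using nn by (auto intro!: mult_right_mono)
    ultimately show ?thesis by linarith
  qed
  then show ?thesis unfolding prox_normal_cone_def
    using assms(1,2) nn by (intro CollectI exI[of _ "\<sigma>1 + \<sigma>2 + 1"]) auto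
qed

text \<open>The quadratic bound minus the pairing vanishes at 0 and is nonnegative for small
  \<open>t > 0\<close>, so its right derivative, to which the quadratic part contributes nothing, is
  nonnegative. Being one-sided, the test also admits curves that merely start into
  \<open>S\<close>.\<close>

lemma prox_normal_along_curve:
  assumes "\<xi> \<in> prox_normal_cone M S x" "q 0 = x"
    and "\<forall>\<^sub>F t in at_right 0. q t \<in> S \<and> q t \<in> chart_dom (chart_at M x)"
    and "((\<lambda>t. chart_map (chart_at M x) (q t)) has_vector_derivative w) (at_right 0)"
  shows "metric M x \<xi> w \<le> 0"
proof -
  let ?k = "chart_at M x"
  let ?u = "\<lambda>t. chart_map ?k (q t) - chart_map ?k x"
  obtain C \<rho> where C: "C \<ge> 0" "\<rho> > 0"
    "\<And>y. y \<in> S \<Longrightarrow> y \<in> chart_dom ?k \<Longrightarrow> norm (chart_map ?k y - chart_map ?k x) < \<rho> \<Longrightarrow>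
      metric M x \<xi> (chart_map ?k y - chart_map ?k x) \<le> C * (norm (chart_map ?k y - chart_map ?k x))\<^sup>2"
    using prox_normal_coord[OF assms(1)] by metis
  have u: "(?u has_vector_derivative w) (at_right 0)"
    using has_vector_derivative_diff[OF assms(4) has_vector_derivative_const] by simp
  have u0: "?u 0 = 0" by (simp add: assms(2))
  have "(?u \<longlongrightarrow> 0) (at_right 0)"
    using has_vector_derivative_continuous[OF u] u0 by (simp add: continuous_within)
  then have near: "\<forall>\<^sub>F t in at_right 0. norm (?u t) < \<rho>"
    using C(2) by (simp add: tendsto_iff)
  let ?f = "\<lambda>t. C * (?u t \<bullet> ?u t) - metric M x \<xi> (?u t)"
  have "bounded_linear (metric M x \<xi>)"
    using metric_props(1)[of x] by (simp add: bilinear_def linear_conv_bounded_linear)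
  then have m: "((\<lambda>t. metric M x \<xi> (?u t)) has_real_derivative metric M x \<xi> w) (at_right 0)"
    using bounded_linear.has_vector_derivative[OF _ u] has_real_derivative_iff_has_vector_derivative by blast
  have "((\<lambda>t. ?u t \<bullet> ?u t) has_derivative (\<lambda>h. ?u 0 \<bullet> (h *\<^sub>R w) + (h *\<^sub>R w) \<bullet> ?u 0)) (at_right 0)"
    using u unfolding has_vector_derivative_def by (intro has_derivative_inner)
  then have n: "((\<lambda>t. ?u t \<bullet> ?u t) has_real_derivative 0) (at_right 0)"
    unfolding u0 has_field_derivative_def by (simp add: lambda_zero)
  have "(?f has_real_derivative (C * 0 - metric M x \<xi> w)) (at_right 0)"
    by (intro DERIV_diff DERIV_cmult m n)
  then have "((\<lambda>t. (?f t - ?f 0) / (t - 0)) \<longlongrightarrow> - metric M x \<xi> w) (at_right 0)"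
    unfolding has_field_derivative_iff by simp
  moreover have "metric M x \<xi> 0 = 0" using bilinear_rzero[OF metric_props(1)] .
  ultimately have lim: "((\<lambda>t. ?f t / t) \<longlongrightarrow> - metric M x \<xi> w) (at_right 0)"
    by (simp add: u0)
  have "\<forall>\<^sub>F t in at_right 0. 0 \<le> ?f t / t"
    using assms(3) near eventually_at_right_less[of 0]
    by eventually_elim (use C(3) in \<open>auto simp: power2_norm_eq_inner\<close>)
  then have "0 \<le> - metric M x \<xi> w"
    by (rule tendsto_lowerbound[OF lim]) simp
  then show ?thesis by simp
qed

lemma prox_normal_subset_normal_space:
  assumes "closed S"
  shows "prox_normal_cone M S x \<subseteq> normal_space_at M (frontier S) x"
proof
  fix \<xi> assume xi: "\<xi> \<in> prox_normal_cone M S x"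
  let ?k = "chart_at M x"
  have at: "?k \<in> atlas M" "x \<in> chart_dom ?k" by (rule chart_at)+
  have "metric M x \<xi> (velocity M {-1..1} c 0) = 0"
    if c: "C1_curve M {-1..1} c" "c ` {-1..1} \<subseteq> frontier S" "c 0 = x" for c
  proof -
    \<comment> \<open>Tangent vectors come from curves on \<open>{-1..1}\<close>, so 0 is an
      interior parameter and the curve can be followed both ways.\<close>
    have I: "at (0::real) within {-1..1} = at 0" by (rule at_within_interior) simp
    obtain D where "((\<lambda>s. chart_map ?k (c s)) has_vector_derivative D) (at 0 within {-1..1})"
      using c(1,3) at unfolding C1_curve_def by fastforce
    then have D: "((\<lambda>s. chart_map ?k (c s)) has_vector_derivative D) (at 0)"
      by (simp add: I)
    have vel: "velocity M {-1..1} c 0 = D"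
      unfolding velocity_def c(3) using D by (simp add: I vector_derivative_at)
    have "continuous (at 0 within {-1..1}) c"
      using c(1) by (auto simp: C1_curve_def continuous_on_eq_continuous_within)
    then have "isCont c 0" by (simp add: I)
    then have "\<forall>\<^sub>F t in at 0. c t \<in> chart_dom ?k"
      using topological_tendstoD[OF _ Ck_chartD(1)[OF atlas_chart[OF at(1), of 1]]] at(2) c(3)
      unfolding isCont_def by blast
    moreover have "\<forall>\<^sub>F t in at (0::real). t \<in> {-1<..<1}"
      by (rule eventually_at_in_open') auto
    ultimately have ev: "\<forall>\<^sub>F t in at 0. c t \<in> S \<and> c t \<in> chart_dom ?k"
    proof eventually_elim
      case (elim t)
      then have "c t \<in> frontier S" using c(2) by force
      then show ?case using frontier_subset_closed[OF assms] elim by auto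
    qed
    have "metric M x \<xi> D \<le> 0"
    proof (rule prox_normal_along_curve[where q = c, OF xi c(3)])
      show "\<forall>\<^sub>F t in at_right 0. c t \<in> S \<and> c t \<in> chart_dom ?k"
        using ev by (simp add: eventually_at_split)
    qed (rule has_vector_derivative_at_within[OF D])
    moreover have "metric M x \<xi> (- D) \<le> 0"
    proof (rule prox_normal_along_curve[OF xi, of "\<lambda>t. c (- t)"])
      have "\<forall>\<^sub>F t in at_left 0. c t \<in> S \<and> c t \<in> chart_dom ?k"
        using ev by (simp add: eventually_at_split)
      then show "\<forall>\<^sub>F t in at_right 0. c (- t) \<in> S \<and> c (- t) \<in> chart_dom ?k"
        using eventually_at_left_to_right[of _ "0::real"] by simp
      have "((\<lambda>s. chart_map ?k (c s)) \<circ> uminus has_vector_derivative (-1) *\<^sub>R D) (at 0)"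
        by (rule vector_diff_chain_at) (use D in \<open>auto intro!: derivative_eq_intros\<close>)
      then show "((\<lambda>t. chart_map ?k (c (- t))) has_vector_derivative - D) (at_right 0)"
        by (simp add: o_def has_vector_derivative_at_within)
    qed (use c in auto)
    ultimately show ?thesis
      using vel bilinear_rneg[OF metric_props(1), of x \<xi> D] by simp
  qed
  then show "\<xi> \<in> normal_space_at M (frontier S) x"
    unfolding normal_space_at_def tangent_space_at_def by auto
qed

end

subsection \<open>The local shape of a set bounded by a submanifold\<close>

text \<open>Any two points are joined through a third point \<open>c\<close> outside
  \<open>span (insert a L)\<close> and \<open>span (insert b L)\<close>, which are proper subspaces
  and hence negligible. A segment to \<open>c\<close> cannot meet \<open>L\<close>, as this would
  put \<open>c\<close> into such a span.\<close>

lemma connected_convex_diff_codim2: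
  fixes L :: "'a::euclidean_space set"
  assumes "convex B" "open B" "subspace L" "dim L + 2 \<le> DIM('a)"
  shows "connected (B - L)"
  unfolding connected_iff_connected_component
proof (intro ballI)
  fix a b assume ab: "a \<in> B - L" "b \<in> B - L"
  have neg: "negligible (span (insert z L))" for z
    by (rule negligible_lowdim) (use assms(4) dim_insert[of z L] in auto)
  have "\<not> negligible B" using open_not_negligible[OF assms(2)] ab by blast
  then obtain c where c: "c \<in> B" "c \<notin> span (insert a L)" "c \<notin> span (insert b L)"
    using negligible_subset[OF negligible_Un[OF neg neg], of B a b] by blast
  have seg: "connected_component (B - L) z c" if z: "z \<in> B - L" "c \<notin> span (insert z L)" for z
    unfolding connected_component_def
  proof (intro exI conjI)
    show "closed_segment z c \<subseteq> B - L"
    proof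
      fix y assume y: "y \<in> closed_segment z c"
      then obtain t where t: "y = (1 - t) *\<^sub>R z + t *\<^sub>R c" "0 \<le> t" "t \<le> 1"
        by (auto simp: in_segment)
      have "y \<notin> L"
      proof
        assume "y \<in> L"
        show False
        proof (cases "t = 0")
          case True
          then show False using t \<open>y \<in> L\<close> z by simp
        next
          case False
          have "c = (1 / t) *\<^sub>R (y - (1 - t) *\<^sub>R z)" using t(1) False by simp
          also have "\<dots> \<in> span (insert z L)"
            using \<open>y \<in> L\<close> by (intro span_mul span_diff) (auto intro: span_base)
          finally show False using z by simp
        qed
      qed
      then show "y \<in> B - L" using closed_segment_subset[OF _ c(1) assms(1)] z y by blast
    qed
  qed (use connected_segment in auto)
  show "connected_component (B - L) a b"
    using seg[OF ab(1) c(2)] seg[OF ab(2) c(3)]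
    by (metis connected_component_sym connected_component_trans)
qed

lemma hyperplane_normal_exists:
  fixes L :: "'a::euclidean_space set"
  assumes "subspace L" "dim L + 1 = DIM('a)"
  obtains n where "n \<noteq> 0" "L = {v. n \<bullet> v = 0}"
proof -
  obtain n where n: "n \<noteq> 0" "span L \<subseteq> {v. n \<bullet> v = 0}"
    using lowdim_subset_hyperplane[of L] assms(2) by auto
  have "L = {v. n \<bullet> v = 0}"
    by (rule subspace_dim_equal[OF assms(1) subspace_hyperplane])
      (use n assms dim_hyperplane[OF n(1)] span_superset[of L] in auto)
  then show ?thesis using that n by blast
qed

context riem
begin

lemma slice_chart_nbhd:
  assumes "Ck_chart M r \<kappa>" "x \<in> chart_dom \<kappa>"
    and "chart_map \<kappa> ` (chart_dom \<kappa> \<inter> N) = chart_map \<kappa> ` chart_dom \<kappa> \<inter> L"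
  obtains \<rho> where "\<rho> > 0" "ball (chart_map \<kappa> x) \<rho> \<subseteq> chart_map \<kappa> ` chart_dom \<kappa>"
    "open (chart_inv \<kappa> ` ball (chart_map \<kappa> x) \<rho>)" "x \<in> chart_inv \<kappa> ` ball (chart_map \<kappa> x) \<rho>"
    "\<And>q. q \<in> ball (chart_map \<kappa> x) \<rho> \<Longrightarrow> chart_inv \<kappa> q \<in> N \<longleftrightarrow> q \<in> L"
proof -
  obtain \<rho> where r: "\<rho> > 0" "cball (chart_map \<kappa> x) \<rho> \<subseteq> chart_map \<kappa> ` chart_dom \<kappa>"
    using chart_nbhd[OF open_UNIV UNIV_I assms(1,2)] by metis
  note k = Ck_chartD[OF assms(1)]
  have sub: "ball (chart_map \<kappa> x) \<rho> \<subseteq> chart_map \<kappa> ` chart_dom \<kappa>" using r(2) ball_subset_cball by blast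
  have x: "x \<in> chart_inv \<kappa> ` ball (chart_map \<kappa> x) \<rho>"
    by (rule image_eqI[of _ _ "chart_map \<kappa> x"]) (use k(4)[OF assms(2)] r in auto)
  have iff: "chart_inv \<kappa> q \<in> N \<longleftrightarrow> q \<in> L" if "q \<in> ball (chart_map \<kappa> x) \<rho>" for q
  proof
    have q: "q \<in> chart_map \<kappa> ` chart_dom \<kappa>" using that sub by blast
    show "q \<in> L" if "chart_inv \<kappa> q \<in> N"
    proof -
      have "chart_map \<kappa> (chart_inv \<kappa> q) \<in> chart_map \<kappa> ` (chart_dom \<kappa> \<inter> N)"
        using k(6)[OF q] that by blast
      then show ?thesis unfolding assms(3) k(5)[OF q] by blast
    qed
    show "chart_inv \<kappa> q \<in> N" if "q \<in> L"
    proof -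
      have "q \<in> chart_map \<kappa> ` (chart_dom \<kappa> \<inter> N)" unfolding assms(3) using q that by blast
      then show ?thesis using k(4) by force
    qed
  qed
  show ?thesis
    by (rule that[OF r(1) sub Ck_chart_open_inv_image[OF assms(1) open_ball sub] x iff])
qed

text \<open>A connected set that meets both \<open>S\<close> and its complement meets the
  frontier.\<close>

lemma connected_chart_inv_side:
  assumes "Ck_chart M r \<kappa>" "connected C" "C \<subseteq> chart_map \<kappa> ` chart_dom \<kappa>"
    and "\<And>q. q \<in> C \<Longrightarrow> chart_inv \<kappa> q \<notin> frontier S"
  shows "chart_inv \<kappa> ` C \<subseteq> S \<or> chart_inv \<kappa> ` C \<inter> S = {}"
proof -
  have "connected (chart_inv \<kappa> ` C)"
    by (rule connected_continuous_image[OF continuous_on_subset[OF Ck_chartD(8)[OF assms(1)] assms(3)] assms(2)])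
  then show ?thesis using connected_Int_frontier[of "chart_inv \<kappa> ` C" S] assms(4) by blast
qed

text \<open>The argument is run at a frontier point \<open>p\<close> of the interior instead of
  \<open>x\<close>, near which \<open>S\<close> may have no interior points. All slices share the
  dimension \<open>k\<close>, so the codimension found at \<open>p\<close> holds everywhere.\<close>

lemma frontier_submanifold_codim1:
  assumes "embedded_submanifold M r k (frontier S)" "closed S" "interior S \<noteq> {}"
    "connected (UNIV :: 'm set)" "x \<in> frontier S"
  shows "k + 1 = DIM('e)"
proof -
  have "x \<notin> interior S" using assms(5) by (simp add: frontier_def)
  \<comment> \<open>The interior is nonempty and misses \<open>x\<close>, so by connectedness of the
    manifold it has a frontier point.\<close>
  then have "frontier (interior S) \<noteq> {}"
    using connected_Int_frontier[OF assms(4), of "interior S"] assms(3) by blast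
  then obtain p where p: "p \<in> frontier (interior S)" by blast
  then have pN: "p \<in> frontier S" using frontier_interior_subset by blast
  obtain \<kappa> L where \<kappa>: "Ck_chart M r \<kappa>" "p \<in> chart_dom \<kappa>" "subspace L" "dim L = k"
    "chart_map \<kappa> ` (chart_dom \<kappa> \<inter> frontier S) = chart_map \<kappa> ` chart_dom \<kappa> \<inter> L"
    using assms(1) pN unfolding embedded_submanifold_def by blast
  obtain \<rho> where \<rho>: "\<rho> > 0" "ball (chart_map \<kappa> p) \<rho> \<subseteq> chart_map \<kappa> ` chart_dom \<kappa>"
    "open (chart_inv \<kappa> ` ball (chart_map \<kappa> p) \<rho>)" "p \<in> chart_inv \<kappa> ` ball (chart_map \<kappa> p) \<rho>"
    "\<And>q. q \<in> ball (chart_map \<kappa> p) \<rho> \<Longrightarrow> chart_inv \<kappa> q \<in> frontier S \<longleftrightarrow> q \<in> L"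
    using slice_chart_nbhd[OF \<kappa>(1,2,5)] by blast
  let ?B = "ball (chart_map \<kappa> p) \<rho>"
  let ?W = "chart_inv \<kappa> ` ?B"
  have NS: "frontier S \<subseteq> S" using assms(2) by (simp add: frontier_subset_closed)
  have WS: "\<not> ?W \<subseteq> S"
  proof
    assume "?W \<subseteq> S"
    then have "p \<in> interior S" using \<rho>(3,4) interior_maximal by blast
    then show False using p by (simp add: frontier_def)
  qed
  \<comment> \<open>A slice of full dimension would make all of \<open>?W\<close> consist of
    frontier points, which lie in the closed set \<open>S\<close>.\<close>
  have "dim L \<noteq> DIM('e)"
  proof
    assume "dim L = DIM('e)"
    then have "L = UNIV" using \<kappa>(3) dim_eq_full span_eq_iff by metis
    then have "?W \<subseteq> S" using \<rho>(5) NS by blast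
    then show False using WS by simp
  qed
  moreover have "\<not> dim L + 2 \<le> DIM('e)"
  proof
    assume d: "dim L + 2 \<le> DIM('e)"
    have con: "connected (?B - L)" by (rule connected_convex_diff_codim2[OF _ _ \<kappa>(3) d]) auto
    have "chart_inv \<kappa> ` (?B - L) \<subseteq> S \<or> chart_inv \<kappa> ` (?B - L) \<inter> S = {}"
      by (rule connected_chart_inv_side[OF \<kappa>(1) con]) (use \<rho>(2,5) in auto)
    moreover have "?W \<inter> interior S \<noteq> {}"
    proof -
      have "p \<in> closure (interior S)" using p by (simp add: frontier_def)
      then show ?thesis using open_Int_closure_eq_empty[OF \<rho>(3), of "interior S"] \<rho>(4) by blast
    qed
    then obtain q where q: "q \<in> ?B" "chart_inv \<kappa> q \<in> interior S" by blast
    then have "chart_inv \<kappa> q \<notin> frontier S" by (simp add: frontier_def)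
    then have "q \<in> ?B - L" using \<rho>(5) q by blast
    moreover have "chart_inv \<kappa> q \<in> S" using q interior_subset by blast
    ultimately have "chart_inv \<kappa> ` (?B - L) \<subseteq> S" by blast
    then have "?W \<subseteq> S" using \<rho>(5) NS by blast
    then show False using WS by simp
  qed
  ultimately show ?thesis using \<kappa>(4) dim_subset_UNIV[of L] by simp
qed

text \<open>Each open half ball misses the frontier and so lies in \<open>S\<close> or off it. Both
  in \<open>S\<close> would make \<open>x\<close> interior; this leaves one side or none.\<close>

lemma frontier_hypersurface_local:
  assumes "embedded_submanifold M r k (frontier S)" "closed S" "x \<in> frontier S" "k + 1 = DIM('e)"
  obtains \<kappa> n \<rho> where "Ck_chart M r \<kappa>" "x \<in> chart_dom \<kappa>" "n \<noteq> 0" "n \<bullet> chart_map \<kappa> x = 0" "\<rho> > 0"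
    "ball (chart_map \<kappa> x) \<rho> \<subseteq> chart_map \<kappa> ` chart_dom \<kappa>"
    "\<And>q. q \<in> ball (chart_map \<kappa> x) \<rho> \<Longrightarrow> chart_inv \<kappa> q \<in> frontier S \<longleftrightarrow> n \<bullet> q = 0"
    "(\<forall>q\<in>ball (chart_map \<kappa> x) \<rho>. chart_inv \<kappa> q \<in> S \<longleftrightarrow> n \<bullet> q \<le> 0) \<or>
     (\<forall>q\<in>ball (chart_map \<kappa> x) \<rho>. chart_inv \<kappa> q \<in> S \<longleftrightarrow> n \<bullet> q = 0)"
proof -
  note goalI = that
  obtain \<kappa> L where \<kappa>: "Ck_chart M r \<kappa>" "x \<in> chart_dom \<kappa>" "subspace L" "dim L = k"
    "chart_map \<kappa> ` (chart_dom \<kappa> \<inter> frontier S) = chart_map \<kappa> ` chart_dom \<kappa> \<inter> L"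
    using assms(1,3) unfolding embedded_submanifold_def by blast
  obtain \<rho> where \<rho>: "\<rho> > 0" "ball (chart_map \<kappa> x) \<rho> \<subseteq> chart_map \<kappa> ` chart_dom \<kappa>"
    "open (chart_inv \<kappa> ` ball (chart_map \<kappa> x) \<rho>)" "x \<in> chart_inv \<kappa> ` ball (chart_map \<kappa> x) \<rho>"
    "\<And>q. q \<in> ball (chart_map \<kappa> x) \<rho> \<Longrightarrow> chart_inv \<kappa> q \<in> frontier S \<longleftrightarrow> q \<in> L"
    using slice_chart_nbhd[OF \<kappa>(1,2,5)] by blast
  obtain n0 where n0: "n0 \<noteq> 0" "L = {v. n0 \<bullet> v = 0}"
    using hyperplane_normal_exists[OF \<kappa>(3)] \<kappa>(4) assms(4) by auto
  let ?B = "ball (chart_map \<kappa> x) \<rho>"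
  let ?I = "chart_inv \<kappa>"
  have fr: "?I q \<in> frontier S \<longleftrightarrow> n0 \<bullet> q = 0" if "q \<in> ?B" for q
    using \<rho>(5)[OF that] n0(2) by simp
  have NS: "frontier S \<subseteq> S" using assms(2) by (simp add: frontier_subset_closed)
  have z: "n0 \<bullet> chart_map \<kappa> x = 0"
    using fr[of "chart_map \<kappa> x"] \<rho>(1) assms(3) Ck_chartD(4)[OF \<kappa>(1,2)] by simp
  have side: "?I ` (?B \<inter> {q. m \<bullet> q < 0}) \<subseteq> S \<or> ?I ` (?B \<inter> {q. m \<bullet> q < 0}) \<inter> S = {}"
    if "m = n0 \<or> m = - n0" for m
  proof (rule connected_chart_inv_side[OF \<kappa>(1)])
    show "connected (?B \<inter> {q. m \<bullet> q < 0})"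
      by (intro convex_connected convex_Int convex_ball convex_halfspace_lt)
    show "?I q \<notin> frontier S" if "q \<in> ?B \<inter> {q. m \<bullet> q < 0}" for q
      using fr[of q] that \<open>m = n0 \<or> m = - n0\<close> by auto
  qed (use \<rho>(2) in auto)
  have notboth: "\<not> (?I ` (?B \<inter> {q. n0 \<bullet> q < 0}) \<subseteq> S \<and> ?I ` (?B \<inter> {q. - n0 \<bullet> q < 0}) \<subseteq> S)"
  proof
    assume *: "?I ` (?B \<inter> {q. n0 \<bullet> q < 0}) \<subseteq> S \<and> ?I ` (?B \<inter> {q. - n0 \<bullet> q < 0}) \<subseteq> S"
    have "?I q \<in> S" if "q \<in> ?B" for q
    proof -
      consider "n0 \<bullet> q < 0" | "- n0 \<bullet> q < 0" | "n0 \<bullet> q = 0" by fastforce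
      then show ?thesis
        by cases (use * fr[OF that] that NS in blast)+
    qed
    then have "?I ` ?B \<subseteq> S" by blast
    then have "x \<in> interior S" using \<rho>(3,4) interior_maximal by blast
    then show False using assms(3) by (simp add: frontier_def)
  qed
  \<comment> \<open>Proved for either sign of the normal, which is then chosen so that
    \<open>S\<close> is on the nonpositive side.\<close>
  have onesided: thesis
    if m: "m = n0 \<or> m = - n0" "?I ` (?B \<inter> {q. m \<bullet> q < 0}) \<subseteq> S" "?I ` (?B \<inter> {q. - m \<bullet> q < 0}) \<inter> S = {}" for m
  proof (rule goalI[OF \<kappa>(1,2), of m \<rho>])
    show "m \<noteq> 0" "m \<bullet> chart_map \<kappa> x = 0" using m(1) n0(1) z by auto
    show "?I q \<in> frontier S \<longleftrightarrow> m \<bullet> q = 0" if "q \<in> ?B" for q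
      using fr[OF that] m(1) by auto
    have "?I q \<in> S \<longleftrightarrow> m \<bullet> q \<le> 0" if q: "q \<in> ?B" for q
    proof -
      consider "m \<bullet> q < 0" | "- m \<bullet> q < 0" | "m \<bullet> q = 0" by fastforce
      then show ?thesis
      proof cases
        case 1
        then have "?I q \<in> S" using m(2) q by blast
        then show ?thesis using 1 by simp
      next
        case 2
        then have "?I q \<notin> S" using m(3) q by blast
        then show ?thesis using 2 by simp
      next
        case 3
        then have "?I q \<in> S" using m(1) NS fr[OF q] by auto
        then show ?thesis using 3 by simp
      qed
    qed
    then show "(\<forall>q\<in>?B. ?I q \<in> S \<longleftrightarrow> m \<bullet> q \<le> 0) \<or> (\<forall>q\<in>?B. ?I q \<in> S \<longleftrightarrow> m \<bullet> q = 0)" by blast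
  qed (use \<rho> in auto)
  consider "?I ` (?B \<inter> {q. n0 \<bullet> q < 0}) \<subseteq> S" "?I ` (?B \<inter> {q. - n0 \<bullet> q < 0}) \<inter> S = {}"
    | "?I ` (?B \<inter> {q. - n0 \<bullet> q < 0}) \<subseteq> S" "?I ` (?B \<inter> {q. n0 \<bullet> q < 0}) \<inter> S = {}"
    | "?I ` (?B \<inter> {q. n0 \<bullet> q < 0}) \<inter> S = {}" "?I ` (?B \<inter> {q. - n0 \<bullet> q < 0}) \<inter> S = {}"
    using side[of n0] side[of "- n0"] notboth by blast
  then show thesis
  proof cases
    case 1
    then show ?thesis using onesided[of n0] by simp
  next
    case 2
    then show ?thesis using onesided[of "- n0"] by simp
  next
    case 3
    have "?I q \<in> S \<longleftrightarrow> n0 \<bullet> q = 0" if q: "q \<in> ?B" for q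
    proof -
      consider "n0 \<bullet> q < 0" | "- n0 \<bullet> q < 0" | "n0 \<bullet> q = 0" by fastforce
      then show ?thesis
      proof cases
        case 1
        then have "?I q \<notin> S" using 3(1) q by blast
        then show ?thesis using 1 by simp
      next
        case 2
        then have "?I q \<notin> S" using 3(2) q by blast
        then show ?thesis using 2 by simp
      next
        case 3
        then show ?thesis using NS fr[OF q] by auto
      qed
    qed
    then show ?thesis using goalI[OF \<kappa>(1,2) n0(1) z \<rho>(1,2) fr] by blast
  qed
qed

end

subsection \<open>Proximal normals along a hypersurface\<close>

text \<open>\<open>Ck_on\<close> controls the derivative of \<open>F\<close> one fixed direction at
  a time. The bounds for the basis directions sum to an operator bound on
  \<open>?D q - ?D p\<close>, and the mean value inequality on a segment gives the quadratic
  remainder.\<close>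

lemma C2_taylor_bound:
  fixes F :: "'a::euclidean_space \<Rightarrow> real"
  assumes "open U" "p \<in> U" "Ck_on 2 F U"
  obtains C \<rho> where "C \<ge> 0" "\<rho> > 0"
    "\<And>q. norm (q - p) < \<rho> \<Longrightarrow> \<bar>F q - F p - frechet_derivative F (at p) (q - p)\<bar> \<le> C * (norm (q - p))\<^sup>2"
proof -
  let ?D = "\<lambda>q. frechet_derivative F (at q)"
  have C2: "Ck_on (Suc (Suc 0)) F U" using assms(3) by (simp add: numeral_2_eq_2)
  have D: "(F has_derivative ?D q) (at q)" if "q \<in> U" for q
    using C2 that by (simp add: frechet_derivative_works[symmetric])
  have "\<exists>B\<ge>0. \<forall>\<^sub>F q in nhds p. \<bar>?D q i - ?D p i\<bar> \<le> B * norm (q - p)" for i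
  proof -
    have "(\<lambda>q. ?D q i) differentiable (at p)" using C2 assms(2) by simp
    then obtain G where G: "((\<lambda>q. ?D q i) has_derivative G) (at p)"
      unfolding differentiable_def by blast
    then obtain K where K: "\<And>v. norm (G v) \<le> norm v * K" "K > 0"
      using has_derivative_bounded_linear bounded_linear.pos_bounded by blast
    obtain d where d: "d > 0" "\<And>q. norm (q - p) < d \<Longrightarrow> norm (?D q i - ?D p i - G (q - p)) \<le> 1 * norm (q - p)"
      using G unfolding has_derivative_at_alt by (meson zero_less_one)
    \<comment> \<open>\<open>K\<close> bounds the linear map \<open>G\<close>, and the added 1 is
      the tolerance chosen for its remainder.\<close>
    have "\<forall>\<^sub>F q in nhds p. \<bar>?D q i - ?D p i\<bar> \<le> (K + 1) * norm (q - p)"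
      unfolding eventually_nhds_metric
    proof (intro exI conjI allI impI)
      show "d > 0" by (rule d)
      fix q assume "dist q p < d"
      then show "\<bar>?D q i - ?D p i\<bar> \<le> (K + 1) * norm (q - p)"
        using norm_triangle_sub[of "?D q i - ?D p i" "G (q - p)"] d(2)[of q] K(1)[of "q - p"]
        by (simp add: dist_norm distrib_right mult.commute[of K])
    qed
    then show ?thesis using K(2) by (intro exI[of _ "K + 1"]) auto
  qed
  then have "\<forall>i. \<exists>b. b \<ge> 0 \<and> (\<forall>\<^sub>F q in nhds p. \<bar>?D q i - ?D p i\<bar> \<le> b * norm (q - p))"
    by blast
  from choice[OF this] obtain B
    where B: "\<And>i. B i \<ge> 0" "\<And>i. \<forall>\<^sub>F q in nhds p. \<bar>?D q i - ?D p i\<bar> \<le> B i * norm (q - p)"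
    by blast
  have "\<forall>\<^sub>F q in nhds p. q \<in> U \<and> (\<forall>i\<in>Basis. \<bar>?D q i - ?D p i\<bar> \<le> B i * norm (q - p))"
    by (intro eventually_conj eventually_ball_finite ballI B finite_Basis eventually_nhds_in_open assms)
  then obtain \<rho> where \<rho>: "\<rho> > 0"
    "\<And>q. dist q p < \<rho> \<Longrightarrow> q \<in> U \<and> (\<forall>i\<in>Basis. \<bar>?D q i - ?D p i\<bar> \<le> B i * norm (q - p))"
    unfolding eventually_nhds_metric by blast
  define C where "C = sum B (Basis :: 'a set)"
  have dev: "\<bar>?D q v - ?D p v\<bar> \<le> C * norm (q - p) * norm v" if q: "dist q p < \<rho>" for q v
  proof -
    have qU: "q \<in> U" using \<rho>(2)[OF q] by blast
    have ex: "?D z v = (\<Sum>i\<in>Basis. (v \<bullet> i) * ?D z i)" if "z \<in> U" for z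
      using Linear_Algebra.linear_componentwise[OF has_derivative_linear[OF D[OF that]], of v 1] by simp
    have "\<bar>?D q v - ?D p v\<bar> = \<bar>\<Sum>i\<in>Basis. (v \<bullet> i) * (?D q i - ?D p i)\<bar>"
      by (simp add: ex[OF qU] ex[OF assms(2)] sum_subtractf right_diff_distrib)
    also have "\<dots> \<le> (\<Sum>i\<in>Basis. \<bar>(v \<bullet> i) * (?D q i - ?D p i)\<bar>)" by (rule sum_abs)
    also have "\<dots> \<le> (\<Sum>i\<in>Basis. norm v * (B i * norm (q - p)))"
      unfolding abs_mult using \<rho>(2)[OF q] by (intro sum_mono mult_mono) (auto simp: Basis_le_norm)
    also have "\<dots> = C * norm (q - p) * norm v"
      by (simp add: C_def sum_distrib_left sum_distrib_right mult_ac)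
    finally show ?thesis .
  qed
  show ?thesis
  proof (rule that[of C \<rho>])
    show "C \<ge> 0" unfolding C_def by (rule sum_nonneg) (rule B)
    fix q assume q: "norm (q - p) < \<rho>"
    have "norm (F q - F p - ?D p (q - p)) \<le> norm (q - p) * (C * norm (q - p))"
    proof (rule differentiable_bound_linearization[of p q "closed_segment p q"])
      show "p + t *\<^sub>R (q - p) \<in> closed_segment p q" if "t \<in> {0..1}" for t
        using that unfolding in_segment by (intro exI[of _ t]) (auto simp: algebra_simps)
      fix z assume z: "z \<in> closed_segment p q"
      then have zq: "norm (z - p) \<le> norm (q - p)" using segment_bound1 by fastforce
      then have zr: "dist z p < \<rho>" using q by (simp add: dist_norm)
      show "(F has_derivative ?D z) (at z within closed_segment p q)"
        using D \<rho>(2)[OF zr] has_derivative_at_withinI by blast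
      show "onorm (?D z - ?D p) \<le> C * norm (q - p)"
      proof (rule onorm_bound)
        show "0 \<le> C * norm (q - p)" using \<open>C \<ge> 0\<close> by simp
        fix v
        have "\<bar>?D z v - ?D p v\<bar> \<le> C * norm (z - p) * norm v" by (rule dev[OF zr])
        also have "\<dots> \<le> C * norm (q - p) * norm v"
          using zq \<open>C \<ge> 0\<close> by (intro mult_right_mono mult_left_mono) auto
        finally show "norm ((?D z - ?D p) v) \<le> C * norm (q - p) * norm v" by simp
      qed
    qed auto
    then show "\<bar>F q - F p - ?D p (q - p)\<bar> \<le> C * (norm (q - p))\<^sup>2"
      by (simp add: power2_eq_square mult_ac)
  qed (rule \<rho>(1))
qed

context riem
begin

section \<open>Gradients and convex neighbourhoods\<close>

lemma metric_eq_imp_eq: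
  assumes "\<And>w. metric M x a w = metric M x b w"
  shows "a = b"
proof (rule ccontr)
  assume "a \<noteq> b"
  then have "metric M x (a - b) (a - b) > 0" by (intro metric_props) simp
  moreover have "metric M x (a - b) (a - b) = 0"
    using assms[of "a - b"] bilinear_lsub[OF metric_props(1)] by simp
  ultimately show False by simp
qed

text \<open>\<open>?A\<close> lowers an index: it sends \<open>v\<close> to the Euclidean
  representative of \<open>metric M x v\<close>. Definiteness makes it injective, hence surjective
  in finite dimension.\<close>

lemma metric_riesz:
  assumes "linear (f :: 'e \<Rightarrow> real)"
  obtains v where "\<And>w. metric M x v w = f w"
proof -
  let ?A = "\<lambda>v. \<Sum>i\<in>Basis. metric M x v i *\<^sub>R i"
  have ex: "f w = (\<Sum>i\<in>Basis. (w \<bullet> i) * f i)" if "linear f" for f :: "'e \<Rightarrow> real" and w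
    using Linear_Algebra.linear_componentwise[OF that, of w 1] by simp
  have mlin: "linear (metric M x v)" "linear (\<lambda>v. metric M x v w)" for v w
    using metric_props(1)[of x] by (simp_all add: bilinear_def)
  have mw: "metric M x v w = ?A v \<bullet> w" for v w
    using ex[OF mlin(1), of v w] by (simp add: inner_sum_left mult.commute inner_commute[of w])
  have lin: "linear ?A"
    by (rule linearI)
      (simp_all add: linear_add[OF mlin(2)] linear_scale[OF mlin(2)] scaleR_left_distrib sum.distrib scaleR_sum_right)
  have "inj ?A"
  proof (rule injI)
    fix a b assume ab: "?A a = ?A b"
    show "a = b"
    proof (rule metric_eq_imp_eq)
      show "metric M x a w = metric M x b w" for w
        unfolding mw[of a w] mw[of b w] ab ..
    qed
  qed
  then have "surj ?A" by (rule linear_injective_imp_surjective[OF lin]) (rule refl)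
  then obtain v where v: "(\<Sum>i\<in>Basis. f i *\<^sub>R i) = ?A v" by (rule surjE)
  have "metric M x v w = f w" for w
    unfolding mw[of v w] v[symmetric] by (simp add: ex[OF assms, of w] inner_sum_left mult.commute inner_commute[of w])
  then show ?thesis using that by blast
qed

lemma gradient_metric:
  assumes "linear (differential M \<psi> x)"
  shows "metric M x (gradient M \<psi> x) w = differential M \<psi> x w"
proof -
  obtain v where v: "\<And>w. metric M x v w = differential M \<psi> x w"
    using metric_riesz[OF assms] by blast
  have "gradient M \<psi> x = v"
    unfolding gradient_def by (rule the_equality) (use v in \<open>auto intro!: metric_eq_imp_eq[of x]\<close>)
  then show ?thesis using v by simp
qed

text \<open>The convex set provided is a metric ball, while proximal normals ask for a topological
  neighbourhood; the distance bound by coordinates places a coordinate ball inside it.\<close>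

lemma prox_regular_convex_nbhd:
  assumes "prox_regular_at M S x"
  obtains U where "x \<in> interior U" "strongly_convex M U"
proof -
  obtain \<epsilon> where e: "\<epsilon> > 0" "strongly_convex M (riem_ball M x \<epsilon>)"
    using assms unfolding prox_regular_at_def by blast
  let ?k = "chart_at M x"
  let ?p = "chart_map ?k x"
  note ck = atlas_chart[OF chart_at(1)[of x], of 1]
  obtain \<rho> where r: "\<rho> > 0" "cball ?p \<rho> \<subseteq> chart_map ?k ` chart_dom ?k"
    using chart_nbhd[OF open_UNIV UNIV_I ck chart_at(2)] by metis
  obtain C where C: "C > 0" "\<And>y. y \<in> chart_dom ?k \<Longrightarrow> norm (chart_map ?k y - ?p) < \<rho> \<Longrightarrow>
       riem_dist M x y \<le> C * norm (chart_map ?k y - ?p)"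
    using riem_dist_le_coordinate_dist[OF r] by metis
  define \<rho>' where "\<rho>' = min \<rho> (\<epsilon> / C)"
  have \<rho>': "\<rho>' > 0" using r e C by (simp add: \<rho>'_def)
  have sub: "ball ?p \<rho>' \<subseteq> chart_map ?k ` chart_dom ?k" using r(2) by (auto simp: \<rho>'_def)
  have "open (chart_inv ?k ` ball ?p \<rho>')" by (rule Ck_chart_open_inv_image[OF ck open_ball sub])
  moreover have "x \<in> chart_inv ?k ` ball ?p \<rho>'"
    by (rule image_eqI[of _ _ ?p]) (use Ck_chartD(4)[OF ck chart_at(2)] \<rho>' in auto)
  moreover have "chart_inv ?k ` ball ?p \<rho>' \<subseteq> riem_ball M x \<epsilon>"
  proof (rule image_subsetI)
    fix q assume q: "q \<in> ball ?p \<rho>'"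
    then have qk: "q \<in> chart_map ?k ` chart_dom ?k" using sub by blast
    have n: "norm (q - ?p) < \<rho>" "C * norm (q - ?p) < \<epsilon>"
      using q C(1) by (auto simp: \<rho>'_def dist_norm norm_minus_commute field_simps)
    have "riem_dist M x (chart_inv ?k q) \<le> C * norm (q - ?p)"
      using C(2)[of "chart_inv ?k q"] Ck_chartD(5,6)[OF ck qk] n(1) by simp
    then show "chart_inv ?k q \<in> riem_ball M x \<epsilon>" using n(2) by (simp add: riem_ball_def)
  qed
  ultimately have "x \<in> interior (riem_ball M x \<epsilon>)" by (meson interiorI)
  then show ?thesis using that e(2) by blast
qed

lemma differential_slice_function:
  assumes "Ck_chart M r \<kappa>" "1 \<le> r" "p \<in> chart_dom \<kappa>"
  shows "((\<lambda>z. n \<bullet> chart_map \<kappa> z) \<circ> chart_inv (chart_at M p) has_derivative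
      differential M (\<lambda>z. n \<bullet> chart_map \<kappa> z) p) (at (chart_map (chart_at M p) p))"
    and "differential M (\<lambda>z. n \<bullet> chart_map \<kappa> z) p w = n \<bullet> trans_deriv (chart_at M p) \<kappa> p w"
proof -
  let ?k = "chart_at M p"
  have "((chart_map \<kappa> \<circ> chart_inv ?k) has_derivative trans_deriv ?k \<kappa> p) (at (chart_map ?k p))"
    by (rule transition_deriv(2)[OF assms(1,2)]) (use assms chart_at in auto)
  then have *: "((\<lambda>z. n \<bullet> chart_map \<kappa> z) \<circ> chart_inv ?k has_derivative (\<lambda>w. n \<bullet> trans_deriv ?k \<kappa> p w))
      (at (chart_map ?k p))"
    unfolding o_def by (rule has_derivative_inner_right)
  have e: "differential M (\<lambda>z. n \<bullet> chart_map \<kappa> z) p = (\<lambda>w. n \<bullet> trans_deriv ?k \<kappa> p w)"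
    unfolding differential_def by (rule frechet_derivative_at[OF *, symmetric])
  show "((\<lambda>z. n \<bullet> chart_map \<kappa> z) \<circ> chart_inv ?k has_derivative
      differential M (\<lambda>z. n \<bullet> chart_map \<kappa> z) p) (at (chart_map ?k p))"
    unfolding e by (rule *)
  show "differential M (\<lambda>z. n \<bullet> chart_map \<kappa> z) p w = n \<bullet> trans_deriv ?k \<kappa> p w" by (simp add: e)
qed

lemma slice_function_submersion:
  assumes "Ck_chart M r \<kappa>" "1 \<le> r" "open U" "U \<subseteq> chart_dom \<kappa>" "n \<noteq> 0"
  shows "Ck_submersion M r U (\<lambda>z. n \<bullet> chart_map \<kappa> z)"
  unfolding Ck_submersion_def
proof (intro conjI ballI)
  show "Ck_function M r U (\<lambda>z. n \<bullet> chart_map \<kappa> z)"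
    unfolding Ck_function_def
  proof
    fix \<kappa>' assume k': "\<kappa>' \<in> atlas M"
    have "Ck_on r (chart_map \<kappa> \<circ> chart_inv \<kappa>') (chart_map \<kappa>' ` (chart_dom \<kappa>' \<inter> U))"
      by (rule Ck_on_mono[OF transition_Ck(2)[OF assms(1) k']]) (use assms(4) in auto)
    then have "Ck_on r (\<lambda>p. n \<bullet> (chart_map \<kappa> \<circ> chart_inv \<kappa>') p) (chart_map \<kappa>' ` (chart_dom \<kappa>' \<inter> U))"
      by (rule Ck_on_inner[OF Ck_chart_open_image[OF atlas_chart[OF k', of 1] assms(3)]])
    then show "Ck_on r ((\<lambda>z. n \<bullet> chart_map \<kappa> z) \<circ> chart_inv \<kappa>') (chart_map \<kappa>' ` (chart_dom \<kappa>' \<inter> U))"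
      by (simp add: o_def)
  qed
  fix p assume "p \<in> U"
  then have p: "p \<in> chart_dom \<kappa>" using assms(4) by blast
  show "surj (differential M (\<lambda>z. n \<bullet> chart_map \<kappa> z) p)"
  proof (rule surjI)
    fix y
    \<comment> \<open>The preimage of \<open>y\<close> is the multiple of \<open>n\<close> whose
      inner product with \<open>n\<close> is \<open>y\<close>, carried to the preferred
      chart.\<close>
    have "trans_deriv (chart_at M p) \<kappa> p (trans_deriv \<kappa> (chart_at M p) p ((y / (n \<bullet> n)) *\<^sub>R n)) = (y / (n \<bullet> n)) *\<^sub>R n"
      by (rule transition_deriv(3)[OF assms(1,2)]) (use p chart_at in auto)
    then show "differential M (\<lambda>z. n \<bullet> chart_map \<kappa> z) p (trans_deriv \<kappa> (chart_at M p) p ((y / (n \<bullet> n)) *\<^sub>R n)) = y"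
      using differential_slice_function(2)[OF assms(1,2) p] assms(5) by simp
  qed
qed

text \<open>The curve that is a straight line in the slice chart has \<open>n \<bullet> chart_map \<kappa>\<close> exactly
  linear along it, so no remainder term decides on which side of the hypersurface it runs.\<close>

lemma prox_normal_slice_direction:
  assumes "Ck_chart M r \<kappa>" "1 \<le> r" "x \<in> chart_dom \<kappa>" "n \<bullet> chart_map \<kappa> x = 0" "\<rho> > 0"
    and "ball (chart_map \<kappa> x) \<rho> \<subseteq> chart_map \<kappa> ` chart_dom \<kappa>"
    and "\<xi> \<in> prox_normal_cone M S x"
    and "\<And>q t. q \<in> ball (chart_map \<kappa> x) \<rho> \<Longrightarrow> t > 0 \<Longrightarrow>
      n \<bullet> q = t * differential M (\<lambda>z. n \<bullet> chart_map \<kappa> z) x w \<Longrightarrow> chart_inv \<kappa> q \<in> S"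
  shows "metric M x \<xi> w \<le> 0"
proof -
  let ?k = "chart_at M x"
  have at: "?k \<in> atlas M" "x \<in> chart_dom ?k" by (rule chart_at)+
  note tr = transition_deriv[OF assms(1,2) at(1) assms(3) at(2)]
  \<comment> \<open>\<open>w\<close> read in the slice chart; the line in this direction regains
    velocity \<open>w\<close> in the preferred chart.\<close>
  let ?v = "trans_deriv ?k \<kappa> x w"
  let ?l = "\<lambda>t. chart_map \<kappa> x + t *\<^sub>R ?v"
  have l: "(?l has_vector_derivative ?v) (at 0 within A)" for A
    by (auto intro!: derivative_eq_intros)
  have "(?l \<longlongrightarrow> chart_map \<kappa> x) (at_right 0)"
    using has_vector_derivative_continuous[OF l] by (simp add: continuous_within)
  then have lim: "\<forall>\<^sub>F t in at_right 0. ?l t \<in> V" if "open V" "chart_map \<kappa> x \<in> V" for V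
    using topological_tendstoD that by blast
  show ?thesis
  proof (rule prox_normal_along_curve[OF assms(7), of "\<lambda>t. chart_inv \<kappa> (?l t)"])
    show "chart_inv \<kappa> (?l 0) = x" using Ck_chartD(4)[OF assms(1,3)] by simp
    have "\<forall>\<^sub>F t in at_right 0. ?l t \<in> ball (chart_map \<kappa> x) \<rho>" by (rule lim) (use assms(5) in auto)
    moreover have "\<forall>\<^sub>F t in at_right 0. ?l t \<in> chart_map \<kappa> ` (chart_dom \<kappa> \<inter> chart_dom ?k)"
      by (rule lim[OF Ck_chart_open_image[OF assms(1) Ck_chartD(1)[OF atlas_chart[OF at(1), of 1]]]])
        (use assms(3) at(2) in auto)
    ultimately show "\<forall>\<^sub>F t in at_right 0. chart_inv \<kappa> (?l t) \<in> S \<and> chart_inv \<kappa> (?l t) \<in> chart_dom ?k"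
      using eventually_at_right_less[of 0]
    proof eventually_elim
      case (elim t)
      then obtain z where z: "?l t = chart_map \<kappa> z" "z \<in> chart_dom \<kappa> \<inter> chart_dom ?k" by blast
      have "chart_inv \<kappa> (?l t) \<in> chart_dom ?k" unfolding z(1) using Ck_chartD(4)[OF assms(1)] z(2) by auto
      moreover have "n \<bullet> ?l t = t * differential M (\<lambda>z. n \<bullet> chart_map \<kappa> z) x w"
        using differential_slice_function(2)[OF assms(1,2,3)] assms(4) by (simp add: inner_add_right)
      then have "chart_inv \<kappa> (?l t) \<in> S" using assms(8) elim by blast
      ultimately show ?case by blast
    qed
    have "((chart_map ?k \<circ> chart_inv \<kappa>) has_derivative trans_deriv \<kappa> ?k x) (at (?l 0))"
      using tr(1) by (simp only: scaleR_zero_left add_0_right)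
    then have "((chart_map ?k \<circ> chart_inv \<kappa>) \<circ> ?l has_vector_derivative trans_deriv \<kappa> ?k x ?v) (at_right 0)"
      by (rule vector_derivative_diff_chain_within[OF l has_derivative_at_withinI])
    then show "((\<lambda>t. chart_map ?k (chart_inv \<kappa> (?l t))) has_vector_derivative w) (at_right 0)"
      unfolding tr(4) by (simp only: comp_def)
  qed
qed

text \<open>The bridge between the charts: membership in \<open>S\<close> is decided by the slice
  function, proximal normality by coordinate differences in the preferred chart.\<close>

lemma slice_function_taylor:
  assumes "Ck_chart M 2 \<kappa>" "x \<in> chart_dom \<kappa>" "n \<bullet> chart_map \<kappa> x = 0" "open W" "x \<in> W"
  obtains C \<rho> where "C \<ge> 0" "\<rho> > 0"
    "\<And>y. y \<in> chart_dom (chart_at M x) \<Longrightarrow>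
      norm (chart_map (chart_at M x) y - chart_map (chart_at M x) x) < \<rho> \<Longrightarrow> y \<in> W \<and>
      \<bar>n \<bullet> chart_map \<kappa> y - differential M (\<lambda>z. n \<bullet> chart_map \<kappa> z) x
          (chart_map (chart_at M x) y - chart_map (chart_at M x) x)\<bar>
        \<le> C * (norm (chart_map (chart_at M x) y - chart_map (chart_at M x) x))\<^sup>2"
proof -
  let ?k = "chart_at M x" and ?\<psi> = "\<lambda>z. n \<bullet> chart_map \<kappa> z"
  have at: "?k \<in> atlas M" "x \<in> chart_dom ?k" by (rule chart_at)+
  note ck = atlas_chart[OF at(1), of 1]
  obtain \<rho>1 where r: "\<rho>1 > 0" "\<And>y. y \<in> chart_dom ?k \<Longrightarrow> norm (chart_map ?k y - chart_map ?k x) \<le> \<rho>1 \<Longrightarrow> y \<in> W"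
    using chart_nbhd[OF assms(4,5) ck at(2)] by metis
  let ?O = "chart_map ?k ` (chart_dom ?k \<inter> chart_dom \<kappa>)"
  have "open ?O" by (rule Ck_chart_open_image[OF ck Ck_chartD(1)[OF assms(1)]])
  moreover have "chart_map ?k x \<in> ?O" using at assms(2) by blast
  moreover have "Ck_on 2 (?\<psi> \<circ> chart_inv ?k) ?O"
  proof -
    have "Ck_on 2 (\<lambda>p. n \<bullet> (chart_map \<kappa> \<circ> chart_inv ?k) p) ?O"
      by (rule Ck_on_inner[OF \<open>open ?O\<close>])
        (use transition_Ck(2)[OF assms(1) at(1)] in \<open>simp only: Int_commute\<close>)
    then show ?thesis by (simp add: o_def)
  qed
  ultimately obtain C \<rho>2 where C: "C \<ge> 0" "\<rho>2 > 0"
    "\<And>q. norm (q - chart_map ?k x) < \<rho>2 \<Longrightarrow>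
      \<bar>(?\<psi> \<circ> chart_inv ?k) q - (?\<psi> \<circ> chart_inv ?k) (chart_map ?k x) - differential M ?\<psi> x (q - chart_map ?k x)\<bar>
        \<le> C * (norm (q - chart_map ?k x))\<^sup>2"
    unfolding differential_def by (rule C2_taylor_bound) blast
  show ?thesis
  proof (rule that[of C "min \<rho>1 \<rho>2"])
    show "min \<rho>1 \<rho>2 > 0" "C \<ge> 0" using r C by auto
    fix y assume y: "y \<in> chart_dom ?k" "norm (chart_map ?k y - chart_map ?k x) < min \<rho>1 \<rho>2"
    show "y \<in> W \<and> \<bar>?\<psi> y - differential M ?\<psi> x (chart_map ?k y - chart_map ?k x)\<bar>
        \<le> C * (norm (chart_map ?k y - chart_map ?k x))\<^sup>2"
      using r(2)[OF y(1)] C(3)[of "chart_map ?k y"] y Ck_chartD(4)[OF ck y(1)] Ck_chartD(4)[OF ck at(2)] assms(3)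
      by simp
  qed
qed

lemma prox_normal_cone_slice:
  assumes "Ck_chart M 2 \<kappa>" "x \<in> chart_dom \<kappa>" "n \<noteq> 0" "n \<bullet> chart_map \<kappa> x = 0" "\<rho> > 0"
    "ball (chart_map \<kappa> x) \<rho> \<subseteq> chart_map \<kappa> ` chart_dom \<kappa>"
    "prox_regular_at M S x"
  defines "g \<equiv> gradient M (\<lambda>z. n \<bullet> chart_map \<kappa> z) x"
  shows "(\<And>q. q \<in> ball (chart_map \<kappa> x) \<rho> \<Longrightarrow> chart_inv \<kappa> q \<in> S \<longleftrightarrow> n \<bullet> q \<le> 0) \<Longrightarrow>
      prox_normal_cone M S x = {l *\<^sub>R g | l. l \<ge> 0}"
    and "(\<And>q. q \<in> ball (chart_map \<kappa> x) \<rho> \<Longrightarrow> chart_inv \<kappa> q \<in> S \<longleftrightarrow> n \<bullet> q = 0) \<Longrightarrow>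
      prox_normal_cone M S x = span {g}"
proof -
  let ?k = "chart_at M x" and ?\<psi> = "\<lambda>z. n \<bullet> chart_map \<kappa> z"
  let ?f = "differential M ?\<psi> x"
  let ?W = "chart_inv \<kappa> ` ball (chart_map \<kappa> x) \<rho>"
  note d = differential_slice_function[OF assms(1) _ assms(2), of n, simplified]
  have lin: "linear ?f" using has_derivative_linear[OF d(1)] .
  have g: "metric M x g w = ?f w" for w unfolding g_def by (rule gradient_metric[OF lin])
  have W: "open ?W" "x \<in> ?W"
  proof -
    show "open ?W" by (rule Ck_chart_open_inv_image[OF assms(1) open_ball assms(6)])
    show "x \<in> ?W"
      by (rule image_eqI[of _ _ "chart_map \<kappa> x"]) (use Ck_chartD(4)[OF assms(1,2)] assms(5) in auto)
  qed
  have "surj ?f"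
    using slice_function_submersion[OF assms(1) _ Ck_chartD(1)[OF assms(1)] order_refl assms(3)] assms(2)
    by (simp add: Ck_submersion_def)
  then obtain w0 where w0: "?f w0 = 1" by (metis surjD)
  obtain U where U: "x \<in> interior U" "strongly_convex M U"
    using prox_regular_convex_nbhd[OF assms(7)] by blast
  obtain C \<rho>1 where C: "C \<ge> 0" "\<rho>1 > 0"
    "\<And>y. y \<in> chart_dom ?k \<Longrightarrow> norm (chart_map ?k y - chart_map ?k x) < \<rho>1 \<Longrightarrow> y \<in> ?W \<and>
      \<bar>?\<psi> y - ?f (chart_map ?k y - chart_map ?k x)\<bar> \<le> C * (norm (chart_map ?k y - chart_map ?k x))\<^sup>2"
    using slice_function_taylor[OF assms(1,2,4) W] by blast
  \<comment> \<open>The sign condition removes \<open>l * ?\<psi> y\<close>, so only the Taylor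
    remainder is left. It holds for \<open>l \<ge> 0\<close> on a half ball and for every
    \<open>l\<close> on the hypersurface.\<close>
  have supset: "l *\<^sub>R g \<in> prox_normal_cone M S x"
    if l: "\<And>q. q \<in> ball (chart_map \<kappa> x) \<rho> \<Longrightarrow> chart_inv \<kappa> q \<in> S \<Longrightarrow> l * (n \<bullet> q) \<le> 0" for l
  proof (rule prox_normal_coordI[OF U, of "\<bar>l\<bar> * C" \<rho>1])
    show "0 \<le> \<bar>l\<bar> * C" "\<rho>1 > 0" using C by auto
    fix y assume y: "y \<in> S" "y \<in> chart_dom ?k" "norm (chart_map ?k y - chart_map ?k x) < \<rho>1"
    let ?w = "chart_map ?k y - chart_map ?k x"
    have "y \<in> ?W" using C(3)[OF y(2,3)] by blast
    then obtain q where q: "q \<in> ball (chart_map \<kappa> x) \<rho>" "y = chart_inv \<kappa> q" by blast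
    have "?\<psi> y = n \<bullet> q" using Ck_chartD(5)[OF assms(1)] assms(6) q by auto
    then have "l * ?\<psi> y \<le> 0" using l[OF q(1)] q(2) y(1) by simp
    moreover have "\<bar>l * (?\<psi> y - ?f ?w)\<bar> \<le> \<bar>l\<bar> * (C * (norm ?w)\<^sup>2)"
      unfolding abs_mult using C(3)[OF y(2,3)] by (intro mult_left_mono) auto
    ultimately have "l * ?f ?w \<le> \<bar>l\<bar> * C * (norm ?w)\<^sup>2" by (simp add: algebra_simps)
    then show "metric M x (l *\<^sub>R g) ?w \<le> \<bar>l\<bar> * C * (norm ?w)\<^sup>2"
      using bilinear_lmul[OF metric_props(1)] g by simp
  qed
  \<comment> \<open>Every \<open>w\<close> splits into a kernel vector of \<open>?f\<close> and
    \<open>?f w *\<^sub>R w0\<close>. On the kernel both signs are admissible, so the pairing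
    vanishes there and \<open>w0\<close> determines the factor.\<close>
  have multiple: "\<xi> = metric M x \<xi> w0 *\<^sub>R g" if "\<And>w. ?f w = 0 \<Longrightarrow> metric M x \<xi> w \<le> 0" for \<xi>
  proof (rule metric_eq_imp_eq)
    fix w
    let ?z = "w - ?f w *\<^sub>R w0"
    have "?f ?z = 0" "?f (- ?z) = 0"
      using w0 by (simp_all add: linear_diff[OF lin] linear_scale[OF lin] linear_neg[OF lin])
    then have "metric M x \<xi> ?z \<le> 0" "metric M x \<xi> (- ?z) \<le> 0" using that by blast+
    then have "metric M x \<xi> ?z = 0" using bilinear_rneg[OF metric_props(1), of x \<xi> ?z] by simp
    then have "metric M x \<xi> w = ?f w * metric M x \<xi> w0"
      using bilinear_rsub[OF metric_props(1), of x \<xi> w "?f w *\<^sub>R w0"] bilinear_rmul[OF metric_props(1), of x \<xi> "?f w" w0]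
      by simp
    then show "metric M x \<xi> w = metric M x (metric M x \<xi> w0 *\<^sub>R g) w"
      using bilinear_lmul[OF metric_props(1)] g by simp
  qed
  note dir = prox_normal_slice_direction[OF assms(1) _ assms(2,4,5,6), simplified]
  show "prox_normal_cone M S x = {l *\<^sub>R g | l. l \<ge> 0}"
    if S: "\<And>q. q \<in> ball (chart_map \<kappa> x) \<rho> \<Longrightarrow> chart_inv \<kappa> q \<in> S \<longleftrightarrow> n \<bullet> q \<le> 0"
  proof
    show "{l *\<^sub>R g | l. l \<ge> 0} \<subseteq> prox_normal_cone M S x"
      using supset S by (auto simp: mult_nonneg_nonpos)
    show "prox_normal_cone M S x \<subseteq> {l *\<^sub>R g | l. l \<ge> 0}"
    proof
      fix \<xi> assume xi: "\<xi> \<in> prox_normal_cone M S x"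
      have neg: "metric M x \<xi> w \<le> 0" if "?f w \<le> 0" for w
        by (rule dir[OF xi]) (use S that in \<open>auto simp: mult_nonneg_nonpos\<close>)
      \<comment> \<open>\<open>- w0\<close> points into \<open>S\<close>, and testing it gives the
        sign of the factor.\<close>
      have "?f (- w0) \<le> 0" using w0 by (simp add: linear_neg[OF lin])
      then have "metric M x \<xi> w0 \<ge> 0"
        using neg[of "- w0"] bilinear_rneg[OF metric_props(1), of x \<xi> w0] by simp
      then show "\<xi> \<in> {l *\<^sub>R g | l. l \<ge> 0}" using multiple[of \<xi>] neg by auto
    qed
  qed
  show "prox_normal_cone M S x = span {g}"
    if S: "\<And>q. q \<in> ball (chart_map \<kappa> x) \<rho> \<Longrightarrow> chart_inv \<kappa> q \<in> S \<longleftrightarrow> n \<bullet> q = 0"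
  proof
    show "span {g} \<subseteq> prox_normal_cone M S x"
      using supset S by (auto simp: span_singleton)
    show "prox_normal_cone M S x \<subseteq> span {g}"
    proof
      fix \<xi> assume xi: "\<xi> \<in> prox_normal_cone M S x"
      have neg: "metric M x \<xi> w \<le> 0" if "?f w = 0" for w
        by (rule dir[OF xi]) (use S that in auto)
      show "\<xi> \<in> span {g}" using multiple[of \<xi>] neg by (auto simp: span_singleton)
    qed
  qed
qed

end

section \<open>Combination of the two parts\<close>

theorem theorem3p4:
  fixes M :: "('m::{t2_space,second_countable_topology}, 'e::euclidean_space) riem_mfd"
    and S :: "'m set" and x :: 'm and k :: nat
  assumes "riemannian_manifold M"
    and "connected (UNIV :: 'm set)"
    and "closed S"
    and "x \<in> frontier S"
  shows "(embedded_submanifold M 1 k (frontier S) \<longrightarrow>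
            prox_normal_cone M S x \<subseteq> normal_space_at M (frontier S) x)
       \<and> (embedded_submanifold M 2 k (frontier S) \<and> prox_regular M S \<and> interior S \<noteq> {} \<longrightarrow>
            (\<exists>U \<psi>. open U \<and> x \<in> U \<and> Ck_submersion M 2 U \<psi> \<and>
               U \<inter> frontier S = {p \<in> U. \<psi> p = 0} \<and>
               (prox_normal_cone M S x = {l *\<^sub>R gradient M \<psi> x | l. l \<ge> 0} \<or>
                prox_normal_cone M S x = span {gradient M \<psi> x})))"
proof -
  interpret riem M by unfold_locales (rule assms(1))
  note S = assms(3) and x = assms(4)
  have "\<exists>U \<psi>. open U \<and> x \<in> U \<and> Ck_submersion M 2 U \<psi> \<and>
      U \<inter> frontier S = {p \<in> U. \<psi> p = 0} \<and>
      (prox_normal_cone M S x = {l *\<^sub>R gradient M \<psi> x | l. l \<ge> 0} \<or>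
       prox_normal_cone M S x = span {gradient M \<psi> x})"
    if emb: "embedded_submanifold M 2 k (frontier S)" and reg: "prox_regular M S"
      and ne: "interior S \<noteq> {}"
  proof -
    have codim: "k + 1 = DIM('e)"
      by (rule frontier_submanifold_codim1[OF emb S ne assms(2) x])
    obtain \<kappa> n \<rho> where \<kappa>: "Ck_chart M 2 \<kappa>" "x \<in> chart_dom \<kappa>"
      and n: "n \<noteq> 0" "n \<bullet> chart_map \<kappa> x = 0"
      and \<rho>: "\<rho> > 0" "ball (chart_map \<kappa> x) \<rho> \<subseteq> chart_map \<kappa> ` chart_dom \<kappa>"
      and fr: "\<And>q. q \<in> ball (chart_map \<kappa> x) \<rho> \<Longrightarrow> chart_inv \<kappa> q \<in> frontier S \<longleftrightarrow> n \<bullet> q = 0"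
      and sides: "(\<forall>q\<in>ball (chart_map \<kappa> x) \<rho>. chart_inv \<kappa> q \<in> S \<longleftrightarrow> n \<bullet> q \<le> 0) \<or>
        (\<forall>q\<in>ball (chart_map \<kappa> x) \<rho>. chart_inv \<kappa> q \<in> S \<longleftrightarrow> n \<bullet> q = 0)"
      using frontier_hypersurface_local[OF emb S x codim] by blast
    \<comment> \<open>The preimage of the ball, not the whole chart domain: the description of
      \<open>S\<close> by sides was obtained on the ball only.\<close>
    let ?U = "chart_inv \<kappa> ` ball (chart_map \<kappa> x) \<rho>" and ?\<psi> = "\<lambda>z. n \<bullet> chart_map \<kappa> z"
    note k = Ck_chartD[OF \<kappa>(1)]
    have "x \<in> S" using x frontier_subset_closed[OF S] by blast
    then have rx: "prox_regular_at M S x" using reg by (simp add: prox_regular_def)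
    have openU: "open ?U" by (rule Ck_chart_open_inv_image[OF \<kappa>(1) open_ball \<rho>(2)])
    have xU: "x \<in> ?U"
      by (rule image_eqI[of _ _ "chart_map \<kappa> x"]) (use k(4)[OF \<kappa>(2)] \<rho>(1) in auto)
    have sub: "Ck_submersion M 2 ?U ?\<psi>"
      by (rule slice_function_submersion[OF \<kappa>(1) _ openU _ n(1)]) (use k(6) \<rho>(2) in auto)
    have "p \<in> frontier S \<longleftrightarrow> ?\<psi> p = 0" if pU: "p \<in> ?U" for p
    proof -
      obtain q where q: "p = chart_inv \<kappa> q" "q \<in> ball (chart_map \<kappa> x) \<rho>" using pU by (rule imageE)
      then have "chart_map \<kappa> p = q" using k(5) \<rho>(2) by blast
      then show ?thesis using fr[OF q(2)] q(1) by simp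
    qed
    then have "?U \<inter> frontier S = {p \<in> ?U. ?\<psi> p = 0}" by blast
    moreover have "prox_normal_cone M S x = {l *\<^sub>R gradient M ?\<psi> x | l. l \<ge> 0} \<or>
        prox_normal_cone M S x = span {gradient M ?\<psi> x}"
      using sides prox_normal_cone_slice[OF \<kappa> n \<rho> rx] by blast
    ultimately show ?thesis
      using openU xU sub by (intro exI[of _ ?U] exI[of _ ?\<psi>]) blast
  qed
  then show ?thesis using prox_normal_subset_normal_space[OF S, of x] by blast
qed

end
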